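(* Let $m\ge2$ and $N\ge1$ be integers, $h=\frac1N$. Let $\ell$ be the error functional of the optimal quadrature formula of the form $$\int_0^1\varphi(x)\,dx\cong\sum_{\beta=0}^N C[\beta]\,\varphi(h\beta)+A\varphi'(0)+B\varphi'(1)$$ in the space $L_2^{(m)}(0,1)$. Then $$\left\|\ell|L_2^{(m)*}(0,1)\right\|^2=(-1)^{m+1}\left[\frac{B_{2m}h^{2m}}{(2m)!}+\frac{h^{2m+1}}{(2m)!}\sum_{k=1}^{m-1}\sum_{i=0}^{2m}\frac{(1-q_k^N)\left(d_kq_k^i+(-1)^ip_kq_k\right)}{(1-q_k)^{i+1}}\,\Delta^i0^{2m}\right],$$ where $B_{2m}$ is a Bernoulli number, $q_1,\dots,q_{m-1}$ are the roots of the Euler polynomial $E_{2m-2}$ with $|q_k|<1$, and $d_k,p_k$ ($k=1,\dots,m-1$) are determined from the system of $2m-2$ linear equations $$\sum_{k=1}^{m-1}\sum_{i=0}^{j}\frac{d_kq_k+p_kq_k^{N+i}(-1)^{i+1}}{(q_k-1)^{i+1}}\,\Delta^i0^j=\frac{B_{j+1}}{j+1},\qquad j=2,\dots,m-1,$$ $$\sum_{k=1}^{m-1}\sum_{i=0}^{2m-2}\frac{d_kq_k+p_kq_k^{N+i}(-1)^{i+1}}{(q_k-1)^{i+1}}\,\Delta^i0^{2m-2}=0,$$ $$\sum_{k=1}^{m-1}\sum_{i=0}^{j}(1-q_k^N)\frac{(-1)^{i+1}d_kq_k^{i}-p_kq_k}{(q_k-1)^{i+1}}\,\Delta^i0^j=0,\qquad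 j=2,\dots,m-1,$$ $$\sum_{k=1}^{m-1}\sum_{i=0}^{2m-2}\frac{(-1)^{i+1}d_kq_k^{N+i}+p_kq_k}{(q_k-1)^{i+1}}\,\Delta^i0^{2m-2}=0.$$
   Context: $L_2^{(m)}(0,1)$ is the Sobolev space of real functions $\varphi$ on $[0,1]$ with $\varphi^{(m)}\in L_2(0,1)$, equipped with the (semi)norm $\|\varphi\|_{L_2^{(m)}(0,1)}=\left(\int_0^1(\varphi^{(m)}(x))^2dx\right)^{1/2}$. For real coefficients $C[0],\dots,C[N],A,B$, the error functional of the quadrature formula is $$(\ell,\varphi)=\int_0^1\varphi(x)\,dx-\sum_{\beta=0}^N C[\beta]\varphi(h\beta)-A\varphi'(0)-B\varphi'(1),$$ that is, $\ell(x)=\varepsilon_{[0,1]}(x)-\sum_{\beta=0}^N C[\beta]\delta(x-h\beta)+A\delta'(x)+B\delta'(x-1)$, where $\varepsilon_{[0,1]}$ is the indicator of $[0,1]$ and $\delta$ is the Dirac delta. Its norm is $\|\ell|L_2^{(m)*}(0,1)\|=\sup_{\|\varphi\|_{L_2^{(m)}(0,1)}=1}|(\ell,\varphi)|$. Finiteness of this norm requires $(\ell,x^\alpha)=0$ for $\alpha=0,\dots,m-1$. The quadrature formula is called optimal (in $L_2^{(m)}(0,1)$) if its coefficients $C[\beta],A,B$ attain the infimum of $\|\ell|L_2^{(m)*}(0,1)\|$ over all choices of $C[\beta]$ ($0\le\beta\le N$), $A$, $B$, with the nodes $h\beta$ fixed. The Euler polynomials are $E_0(x)=1$ and $E_k(x)=\frac{(1-x)^{k+2}}{x}\left(x\frac{d}{dx}\right)^k\frac{x}{(1-x)^2}$,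 $k\ge1$; $E_k$ has degree $k$. $E_{2m-2}$ has exactly $m-1$ roots in the unit disc $|q|<1$. $B_j$ denotes the $j$-th Bernoulli number. $\Delta^i\gamma^j$ is the $i$-th forward finite difference (step 1) of the function $\gamma\mapsto\gamma^j$, and $\Delta^i0^j=\Delta^i\gamma^j|_{\gamma=0}$. *)

theory Defs
  imports "HOL-Analysis.Analysis" "HOL-Computational_Algebra.Computational_Algebra"
begin

section \<open>The space L_2^(m)(0,1)\<close>

text \<open>The \<open>k\<close>-th classical derivative on \<open>[0,1]\<close>, one-sided at the end points. It depends only on the
  values of the function on \<open>[0,1]\<close>.\<close>

definition nderiv :: "nat \<Rightarrow> (real \<Rightarrow> real) \<Rightarrow> real \<Rightarrow> real" where
  "nderiv k = (\<lambda>f x. vector_derivative f (at x within {0..1})) ^^ k"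

text \<open>\<open>g\<close> represents \<open>\<phi>^(m)\<close> (\<open>m \<ge> 1\<close>) in \<open>L_2(0,1)\<close>: \<open>\<phi>\<close> is \<open>m-1\<close> times differentiable on \<open>[0,1]\<close>,
  and \<open>\<phi>^(m-1)\<close> is absolutely continuous with almost everywhere derivative \<open>g\<close>, that is, it is the
  indefinite Lebesgue integral of \<open>g\<close>. (Square integrability of \<open>g\<close> on \<open>[0,1]\<close> implies
  integrability.) Elements of the Sobolev space are thus taken as their continuous
  representatives, so that point values are meaningful.\<close>

definition has_L2_deriv :: "nat \<Rightarrow> (real \<Rightarrow> real) \<Rightarrow> (real \<Rightarrow> real) \<Rightarrow> bool" where
  "has_L2_deriv m \<phi> g \<longleftrightarrow>
     (\<forall>k<m - 1. \<forall>x\<in>{0..1}. nderiv k \<phi> differentiable (at x within {0..1})) \<and>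
     g \<in> borel_measurable lborel \<and>
     set_integrable lborel {0..1} (\<lambda>x. (g x)\<^sup>2) \<and>
     (\<forall>x\<in>{0..1}. nderiv (m - 1) \<phi> x = nderiv (m - 1) \<phi> 0 + (LINT t:{0..x}|lborel. g t))"

definition L2_deriv :: "nat \<Rightarrow> (real \<Rightarrow> real) \<Rightarrow> real \<Rightarrow> real" where
  "L2_deriv m \<phi> = (SOME g. has_L2_deriv m \<phi> g)"

definition sobolev :: "nat \<Rightarrow> (real \<Rightarrow> real) set" where
  "sobolev m = {\<phi>. \<exists>g. has_L2_deriv m \<phi> g}"

definition sobolev_norm :: "nat \<Rightarrow> (real \<Rightarrow> real) \<Rightarrow> real" where
  "sobolev_norm m \<phi> = sqrt (LINT x:{0..1}|lborel. (L2_deriv m \<phi> x)\<^sup>2)"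


section \<open>The error functional and optimal quadrature formulas\<close>

text \<open>Only the coefficients \<open>C 0, \<dots>, C N\<close> are used.\<close>

definition quad_error ::
  "nat \<Rightarrow> (nat \<Rightarrow> real) \<Rightarrow> real \<Rightarrow> real \<Rightarrow> (real \<Rightarrow> real) \<Rightarrow> real" where
  "quad_error N C A B \<phi> = (let h = 1 / real N in
     (LINT x:{0..1}|lborel. \<phi> x) - (\<Sum>\<beta>=0..N. C \<beta> * \<phi> (h * real \<beta>))
       - A * nderiv 1 \<phi> 0 - B * nderiv 1 \<phi> 1)"

definition error_norm :: "nat \<Rightarrow> nat \<Rightarrow> (nat \<Rightarrow> real) \<Rightarrow> real \<Rightarrow> real \<Rightarrow> ereal" where
  "error_norm m N C A B =
     (SUP \<phi>\<in>{\<phi> \<in> sobolev m. sobolev_norm m \<phi> = 1}. ereal \<bar>quad_error N C A B \<phi>\<bar>)"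

text \<open>The error functional of an optimal formula has to be an element of the dual space, so its
  norm is required to be finite. This is not automatic: if \<open>N\<close> is small compared with \<open>m\<close>, there
  may be no formula that is exact on polynomials of degree less than \<open>m\<close>, and then no optimal
  formula exists.\<close>

definition optimal_quadrature ::
  "nat \<Rightarrow> nat \<Rightarrow> (nat \<Rightarrow> real) \<Rightarrow> real \<Rightarrow> real \<Rightarrow> bool" where
  "optimal_quadrature m N C A B \<longleftrightarrow>
     error_norm m N C A B < \<infinity> \<and>
     (\<forall>C' A' B'. error_norm m N C A B \<le> error_norm m N C' A' B')"


section \<open>Euler polynomials, Bernoulli numbers, finite differences\<close>

text \<open>The defining formula is singular at \<open>0\<close> and \<open>1\<close>; as a polynomial, \<open>E_k\<close> is determined by its
  values elsewhere (see \<open>poly_euler_poly\<close> below). For \<open>k = 0\<close> the formula gives \<open>E_0 = 1\<close>.\<close>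

definition euler_poly :: "nat \<Rightarrow> complex poly" where
  "euler_poly k = (THE p. \<forall>x. x \<noteq> 0 \<and> x \<noteq> 1 \<longrightarrow>
     poly p x = (1 - x) ^ (k + 2) / x *
       ((\<lambda>f z. z * deriv f z) ^^ k) (\<lambda>z. z / (1 - z)\<^sup>2) x)"

definition bernoulli_num :: "nat \<Rightarrow> real" where
  "bernoulli_num n = fact n * fps_nth (fps_X / (fps_exp 1 - 1)) n"

definition fwd_diff :: "(real \<Rightarrow> real) \<Rightarrow> real \<Rightarrow> real" where
  "fwd_diff f x = f (x + 1) - f x"

text \<open>\<open>\<Delta>^i 0^j\<close>\<close>
definition diff_pow0 :: "nat \<Rightarrow> nat \<Rightarrow> real" where
  "diff_pow0 i j = (fwd_diff ^^ i) (\<lambda>\<gamma>. \<gamma> ^ j) 0"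


section \<open>Well-definedness\<close>

lemma euler_operator_form:
  "\<exists>p::complex poly. \<forall>x. x \<noteq> 1 \<longrightarrow>
     ((\<lambda>f z. z * deriv f z) ^^ k) (\<lambda>z. z / (1 - z)\<^sup>2) x = x * poly p x / (1 - x) ^ (k + 2)"
proof (induction k)
  case 0
  show ?case by (rule exI[of _ 1]) (simp add: power2_eq_square)
next
  case (Suc k)
  let ?F = "((\<lambda>f z. z * deriv f z) ^^ k) (\<lambda>z::complex. z / (1 - z)\<^sup>2)"
  from Suc obtain p where p: "\<And>x. x \<noteq> 1 \<Longrightarrow> ?F x = x * poly p x / (1 - x) ^ (k + 2)"
    by blast
  define n where "n = k + 2"
  define P where "P = (p + [:0, 1:] * pderiv p) * [:1, -1:] + smult (of_nat n) ([:0, 1:] * p)"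
  have "x * deriv ?F x = x * poly P x / (1 - x) ^ Suc n" if x: "x \<noteq> 1" for x
  proof -
    have ev: "\<forall>\<^sub>F z in nhds x. ?F z = z * poly p z / (1 - z) ^ n"
      using x p unfolding n_def by (intro eventually_mono[OF t1_space_nhds[OF x]]) auto
    have ne: "(1 - x) ^ n \<noteq> 0" using x by simp
    have num: "((\<lambda>z. z * poly p z) has_field_derivative (poly p x + x * poly (pderiv p) x)) (at x)"
      by (rule derivative_eq_intros refl poly_DERIV | simp)+
    have den: "((\<lambda>z. (1 - z) ^ n) has_field_derivative (- of_nat n * (1 - x) ^ (n - 1))) (at x)"
      by (rule derivative_eq_intros refl | simp)+
    have D: "((\<lambda>z. z * poly p z / (1 - z) ^ n) has_field_derivative
              (((poly p x + x * poly (pderiv p) x) * (1 - x) ^ n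
                - x * poly p x * (- of_nat n * (1 - x) ^ (n - 1))) / ((1 - x) ^ n * (1 - x) ^ n))) (at x)"
      by (rule DERIV_divide[OF num den ne])
    have pw: "(1 - x) ^ n = (1 - x) * (1 - x) ^ (n - 1)"
      by (simp add: n_def)
    have "deriv ?F x = deriv (\<lambda>z. z * poly p z / (1 - z) ^ n) x"
      by (rule deriv_cong_ev[OF ev refl])
    also have "\<dots> = ((poly p x + x * poly (pderiv p) x) * (1 - x) ^ n
                - x * poly p x * (- of_nat n * (1 - x) ^ (n - 1))) / ((1 - x) ^ n * (1 - x) ^ n)"
      by (rule DERIV_imp_deriv[OF D])
    also have "\<dots> = ((1 - x) ^ (n - 1) * ((poly p x + x * poly (pderiv p) x) * (1 - x)
                + of_nat n * (x * poly p x))) / ((1 - x) ^ (n - 1) * ((1 - x) * (1 - x) ^ n))"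
      by (simp add: pw algebra_simps)
    also have "\<dots> = ((poly p x + x * poly (pderiv p) x) * (1 - x) + of_nat n * (x * poly p x))
                     / (1 - x) ^ Suc n"
      using x by (subst mult_divide_mult_cancel_left) auto
    also have "\<dots> = poly P x / (1 - x) ^ Suc n"
      by (simp add: P_def algebra_simps)
    finally show ?thesis by simp
  qed
  then show ?case by (intro exI[of _ P]) (simp add: n_def)
qed

lemma poly_euler_poly:
  assumes "x \<noteq> 0" "x \<noteq> 1"
  shows "poly (euler_poly k) x = (1 - x) ^ (k + 2) / x *
           ((\<lambda>f z. z * deriv f z) ^^ k) (\<lambda>z. z / (1 - z)\<^sup>2) x"
proof -
  let ?R = "\<lambda>x::complex. (1 - x) ^ (k + 2) / x * ((\<lambda>f z. z * deriv f z) ^^ k) (\<lambda>z. z / (1 - z)\<^sup>2) x"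
  obtain p :: "complex poly" where p: "\<And>x. x \<noteq> 1 \<Longrightarrow>
      ((\<lambda>f z. z * deriv f z) ^^ k) (\<lambda>z. z / (1 - z)\<^sup>2) x = x * poly p x / (1 - x) ^ (k + 2)"
    using euler_operator_form by blast
  have pR: "\<forall>x. x \<noteq> 0 \<and> x \<noteq> 1 \<longrightarrow> poly p x = ?R x"
    by (simp add: p del: power_Suc power_add add_2_eq_Suc')
  have "\<exists>!p. \<forall>x. x \<noteq> 0 \<and> x \<noteq> 1 \<longrightarrow> poly p x = ?R x"
  proof (rule ex1I[of _ p])
    show "\<forall>x. x \<noteq> 0 \<and> x \<noteq> 1 \<longrightarrow> poly p x = ?R x"
      by (rule pR)
  next
    fix q assume q: "\<forall>x. x \<noteq> 0 \<and> x \<noteq> 1 \<longrightarrow> poly q x = ?R x"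
    with pR have "- {0, 1} \<subseteq> {x. poly (q - p) x = 0}" by auto
    moreover have "infinite (- {0, 1 :: complex})"
      by (simp add: infinite_UNIV_char_0 Compl_eq_Diff_UNIV)
    ultimately have "infinite {x. poly (q - p) x = 0}"
      using finite_subset by blast
    then have "q - p = 0" using poly_roots_finite by blast
    then show "q = p" by simp
  qed
  from theI'[OF this] assms show ?thesis unfolding euler_poly_def by blast
qed

lemma AE_eq_of_integral_eq:
  fixes f g :: "real \<Rightarrow> real"
  assumes f: "set_integrable lborel {0..1} f" and g: "set_integrable lborel {0..1} g"
    and eq: "\<And>x. x \<in> {0..1} \<Longrightarrow> (LINT t:{0..x}|lborel. f t) = (LINT t:{0..x}|lborel. g t)"
  shows "AE x in lborel. x \<in> {0..1} \<longrightarrow> f x = g x"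
proof -
  define u where "u x = indicator {0..1} x *\<^sub>R f x - indicator {0..1} x *\<^sub>R g x" for x :: real
  have u: "integrable lborel u"
    using f g unfolding u_def set_integrable_def by (rule Bochner_Integration.integrable_diff)
  have [measurable]: "u \<in> borel_measurable borel"
    using borel_measurable_integrable[OF u] by simp
  have u_le: "(LINT t:{..x}|lborel. u t) = 0" for x
  proof -
    have *: "(LINT t:{0..y}|lborel. f t) - (LINT t:{0..y}|lborel. g t) = (LINT t:{..x}|lborel. u t)"
      if "{0..1} \<inter> {..x} = {0..y}" "{0..y} \<subseteq> {0..1}" for y
    proof -
      have "set_integrable lborel {0..y} f" "set_integrable lborel {0..y} g"
        using f g that(2) by (auto intro: set_integrable_subset)
      then have "(LINT t:{0..y}|lborel. f t) - (LINT t:{0..y}|lborel. g t)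
          = (LINT t:{0..y}|lborel. f t - g t)"
        by (rule set_integral_diff(2)[symmetric])
      also have "\<dots> = (LINT t:{..x}|lborel. u t)"
        unfolding set_lebesgue_integral_def that(1)[symmetric] u_def
        by (intro Bochner_Integration.integral_cong) (auto simp: indicator_def)
      finally show ?thesis .
    qed
    consider "x < 0" | "0 \<le> x" "x \<le> 1" | "1 < x" by linarith
    then show ?thesis
    proof cases
      case 1
      then have "(\<lambda>t. indicator {..x} t *\<^sub>R u t) = (\<lambda>_. 0)"
        by (auto simp: fun_eq_iff u_def indicator_def)
      then show ?thesis unfolding set_lebesgue_integral_def by (simp only: integral_zero)
    next
      case 2
      then show ?thesis using *[of x] eq[of x] by auto
    next
      case 3
      then show ?thesis using *[of 1] eq[of 1] by auto
    qed
  qed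
  have "set_integrable lborel A u" if "A \<in> sets lborel" for A
    using u that unfolding set_integrable_def by (intro integrable_mult_indicator)
  then have split: "(LINT t|lborel. u t) = (LINT t:{..x}|lborel. u t) + (LINT t:{x<..}|lborel. u t)" for x
  proof -
    have "{..x} \<union> {x<..} = UNIV" "{..x} \<inter> {x<..} = {}" by auto
    with set_integral_Un[of "{..x}" "{x<..}" lborel u]
      \<open>\<And>A. A \<in> sets lborel \<Longrightarrow> set_integrable lborel A u\<close>
    show ?thesis by (simp add: set_lebesgue_integral_def)
  qed
  have total: "(LINT t|lborel. u t) = 0"
  proof -
    have "(LINT t:{1<..}|lborel. u t) = 0"
    proof -
      have "(\<lambda>t. indicator {1<..} t *\<^sub>R u t) = (\<lambda>_. 0)"
        by (auto simp: fun_eq_iff u_def indicator_def)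
      then show ?thesis unfolding set_lebesgue_integral_def by (simp only: integral_zero)
    qed
    then show ?thesis using split[of 1] u_le[of 1] by simp
  qed
  have u_gt: "(LINT t:{x<..}|lborel. u t) = 0" for x
    using split[of x] u_le[of x] total by simp
  define M1 where "M1 = density lborel (\<lambda>x. ennreal (max 0 (u x)))"
  define M2 where "M2 = density lborel (\<lambda>x. ennreal (max 0 (- u x)))"
  have int1: "integrable lborel (\<lambda>t. indicator {x<..} t *\<^sub>R max 0 (u t))"
   and int2: "integrable lborel (\<lambda>t. indicator {x<..} t *\<^sub>R max 0 (- u t))" for x
    using u by (intro integrable_mult_indicator integrable_max integrable_zero integrable_minus; simp)+
  have em1: "emeasure M1 {x<..} = ennreal (LINT t:{x<..}|lborel. max 0 (u t))" for x
  proof -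
    have "emeasure M1 {x<..} = (\<integral>\<^sup>+t. ennreal (indicator {x<..} t *\<^sub>R max 0 (u t)) \<partial>lborel)"
      unfolding M1_def
      by (subst emeasure_density) (auto intro!: nn_integral_cong simp: indicator_def)
    also have "\<dots> = ennreal (LINT t:{x<..}|lborel. max 0 (u t))"
      unfolding set_lebesgue_integral_def by (intro nn_integral_eq_integral int1) auto
    finally show ?thesis .
  qed
  have em2: "emeasure M2 {x<..} = ennreal (LINT t:{x<..}|lborel. max 0 (- u t))" for x
  proof -
    have "emeasure M2 {x<..} = (\<integral>\<^sup>+t. ennreal (indicator {x<..} t *\<^sub>R max 0 (- u t)) \<partial>lborel)"
      unfolding M2_def
      by (subst emeasure_density) (auto intro!: nn_integral_cong simp: indicator_def)
    also have "\<dots> = ennreal (LINT t:{x<..}|lborel. max 0 (- u t))"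
      unfolding set_lebesgue_integral_def by (intro nn_integral_eq_integral int2) auto
    finally show ?thesis .
  qed
  have "(LINT t:{x<..}|lborel. max 0 (u t)) - (LINT t:{x<..}|lborel. max 0 (- u t)) = 0" for x
  proof -
    have "(LINT t:{x<..}|lborel. max 0 (u t)) - (LINT t:{x<..}|lborel. max 0 (- u t))
        = (LINT t:{x<..}|lborel. u t)"
      unfolding set_lebesgue_integral_def Bochner_Integration.integral_diff[OF int1 int2, symmetric]
      by (intro Bochner_Integration.integral_cong) (auto simp: indicator_def)
    then show ?thesis using u_gt by simp
  qed
  then have "M1 = M2"
    by (intro measure_eqI_lessThan) (auto simp: em1 em2, auto simp: M1_def M2_def)
  then have "AE x in lborel. ennreal (max 0 (u x)) = ennreal (max 0 (- u x))"
    unfolding M1_def M2_def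
    by (intro sigma_finite_measure.density_unique[OF sigma_finite_lborel]) auto
  then show ?thesis
  proof eventually_elim
    case (elim x)
    then have "max 0 (u x) = max 0 (- u x)" by simp
    then have "u x = 0" by linarith
    then show ?case by (auto simp: u_def indicator_def split: if_splits)
  qed
qed

lemma sobolev_norm_eq:
  assumes "has_L2_deriv m \<phi> g"
  shows "sobolev_norm m \<phi> = sqrt (LINT x:{0..1}|lborel. (g x)\<^sup>2)"
proof -
  define g' where "g' = L2_deriv m \<phi>"
  have g': "has_L2_deriv m \<phi> g'"
    unfolding g'_def L2_deriv_def using assms by (rule someI[of "has_L2_deriv m \<phi>"])
  have integrable: "set_integrable lborel {0..1} f" if "has_L2_deriv m \<phi> f" for f
  proof -
    have "set_integrable lborel {0..1} (\<lambda>x. 1 + (f x)\<^sup>2)"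
      using that unfolding has_L2_deriv_def
      by (intro set_integral_add borel_integrable_atLeastAtMost'[of 0 1 "\<lambda>_. 1"]) auto
    then show ?thesis
    proof (rule set_integrable_bound)
      show "set_borel_measurable lborel {0..1} f"
        using that unfolding has_L2_deriv_def set_borel_measurable_def by auto
      have "\<bar>y\<bar> \<le> \<bar>1 + y\<^sup>2\<bar>" for y :: real
        using sum_squares_bound[of 1 "\<bar>y\<bar>"] by simp
      then show "AE x in lborel. x \<in> {0..1} \<longrightarrow> norm (f x) \<le> norm (1 + (f x)\<^sup>2)"
        by simp
    qed
  qed
  have ae: "AE x in lborel. x \<in> {0..1} \<longrightarrow> g' x = g x"
  proof (rule AE_eq_of_integral_eq)
    show "set_integrable lborel {0..1} g'" by (rule integrable[OF g'])
    show "set_integrable lborel {0..1} g" by (rule integrable[OF assms])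
    fix x :: real assume "x \<in> {0..1}"
    then have "nderiv (m - 1) \<phi> x = nderiv (m - 1) \<phi> 0 + (LINT t:{0..x}|lborel. g' t)"
      and "nderiv (m - 1) \<phi> x = nderiv (m - 1) \<phi> 0 + (LINT t:{0..x}|lborel. g t)"
      using assms g' unfolding has_L2_deriv_def by blast+
    then show "(LINT t:{0..x}|lborel. g' t) = (LINT t:{0..x}|lborel. g t)"
      by linarith
  qed
  have [measurable]: "g \<in> borel_measurable lborel" "g' \<in> borel_measurable lborel"
    using assms g' unfolding has_L2_deriv_def by blast+
  have "(LINT x:{0..1}|lborel. (g' x)\<^sup>2) = (LINT x:{0..1}|lborel. (g x)\<^sup>2)"
    unfolding set_lebesgue_integral_def
  proof (rule integral_cong_AE)
    show "AE x in lborel. indicator {0..1} x *\<^sub>R (g' x)\<^sup>2 = indicator {0..1} x *\<^sub>R (g x)\<^sup>2"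
      using ae by eventually_elim (simp add: indicator_def)
  qed measurable
  then show ?thesis unfolding sobolev_norm_def g'_def by simp
qed

end

theory Submission
  imports Defs
begin

text \<open>The error of a quadrature formula that is exact for polynomials of degree less than \<open>m\<close> is
\<open>\<integral> \<phi>^(m) \<kappa>\<close> with a Peano kernel \<open>\<kappa>\<close>, and its norm is the \<open>L_2\<close>-norm of \<open>\<kappa>\<close>. As the coefficients of the
formula vary, \<open>\<kappa>\<close> runs through splines of degree \<open>m\<close> with fixed leading coefficient, so the formula is
optimal when \<open>\<kappa>\<close> is orthogonal to the possible variations. This leads to an extremal function
\<open>\<psi>\<close> with \<open>\<psi>^(m) = \<kappa>\<close>: a spline of degree \<open>2 m\<close> with \<open>\<psi>^(2m) = (-1)^m\<close>, which vanishes at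
all nodes, whose derivative vanishes at 0 and 1, and whose derivatives of orders \<open>m\<close> to \<open>2 m - 3\<close> vanish
at 0 and 1. Such a \<open>\<psi>\<close> settles everything (lemma \<open>optimal_error_norm\<close>): its
\<open>m\<close>-th derivative is the kernel of a formula with error norm \<open>sqrt (\<integral> \<kappa>\<^sup>2)\<close>, and \<open>\<psi>\<close> itself shows that no formula
has a smaller one, since every quadrature sum gives 0 for \<open>\<psi>\<close>. Moreover the square of the norm is
\<open>\<integral> \<kappa>\<^sup>2 = \<integral> \<psi>\<close>.

It remains to write down \<open>\<psi>\<close>. The periodic Bernoulli spline of degree \<open>2 m\<close> minus its value at the nodes vanishes at all
nodes. To it one may add splines of degree \<open>2 m - 1\<close> that vanish at all nodes, and these are provided
by the exponential splines that are multiplied by \<open>r\<close> under translation by the mesh width: the value at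
0 of such a spline is, up to a factor, the Euler polynomial at \<open>r\<close> (lemma \<open>euler_poly_root\<close>), so that
\<open>r\<close> may be any of the \<open>q k\<close> and, by symmetry (lemma \<open>apostol_fps_reflect\<close>), any of the \<open>1 / q k\<close>. Their
\<open>2 m - 2\<close> weights are the \<open>d k\<close> and \<open>p k\<close>, and the linear system expresses exactly the \<open>2 m - 2\<close> conditions
on the derivatives of \<open>\<psi>\<close> at the ends. The integral of \<open>\<psi>\<close> is the difference of the
boundary values of its antiderivative, which is a spline of the same kind; this gives the formula.

All boundary and node values are computed with generating functions: the derivatives of a spline at
a point are the coefficients of a power series, and translation by the mesh width multiplies this series by
\<open>exp t\<close>, up to the contribution of the jumps. Since the \<open>q k\<close>, \<open>d k\<close>, \<open>p k\<close> are complex numbers, the construction yields a complex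
spline; its real part is \<open>\<psi>\<close> and its imaginary part has integral 0 (lemma
\<open>null_spline_integral_eq_0\<close>).\<close>

section \<open>Absolutely continuous functions on the unit interval\<close>

text \<open>Absolute continuity on \<open>[0,1]\<close> in the form in which it enters the definition of the Sobolev space.
It covers both the highest derivative of a Sobolev function, which is merely integrable, and the
discontinuous derivative of a piecewise quadratic spline, so that one rule for integration by parts
serves all steps of the argument.\<close>

definition has_L1_deriv :: "(real \<Rightarrow> real) \<Rightarrow> (real \<Rightarrow> real) \<Rightarrow> bool" where
  "has_L1_deriv F f \<longleftrightarrow> set_integrable lborel {0..1} f \<and>
     (\<forall>x\<in>{0..1}. F x = F 0 + (LINT t:{0..x}|lborel. f t))"

lemma has_L1_deriv_HK:
  assumes "has_L1_deriv F f" "x \<in> {0..1}"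
  shows "F x = F 0 + integral {0..x} f"
proof -
  have "set_integrable lborel {0..x} f"
    using assms unfolding has_L1_deriv_def by (auto intro: set_integrable_subset)
  then show ?thesis
    using assms set_borel_integral_eq_integral(2) unfolding has_L1_deriv_def by metis
qed

lemma has_L1_deriv_integrable: "has_L1_deriv F f \<Longrightarrow> set_integrable lborel {0..1} f"
  unfolding has_L1_deriv_def by blast

lemma has_L1_derivD:
  "has_L1_deriv F f \<Longrightarrow> x \<in> {0..1} \<Longrightarrow> F x = F 0 + (LINT t:{0..x}|lborel. f t)"
  unfolding has_L1_deriv_def by blast

lemma has_L1_deriv_integral:
  assumes "has_L1_deriv F f"
  shows "(LINT x:{0..1}|lborel. f x) = F 1 - F 0"
proof -
  have "F 1 = F 0 + (LINT x:{0..1}|lborel. f x)"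
    by (rule has_L1_derivD[OF assms]) simp
  then show ?thesis by linarith
qed

lemma has_L1_deriv_continuous:
  assumes "has_L1_deriv F f"
  shows "continuous_on {0..1} F"
proof -
  have "f integrable_on {0..1}"
    using assms unfolding has_L1_deriv_def by (intro set_borel_integral_eq_integral) auto
  then have "continuous_on {0..1} (\<lambda>x. F 0 + integral {0..x} f)"
    by (intro continuous_intros indefinite_integral_continuous_1)
  then show ?thesis
    by (rule continuous_on_eq) (rule has_L1_deriv_HK[OF assms, symmetric])
qed

lemma has_L1_deriv_imp_has_vector_derivative:
  assumes "has_L1_deriv F f" "continuous_on {0..1} f" "x \<in> {0..1}"
  shows "(F has_vector_derivative f x) (at x within {0..1})"
proof -
  have "((\<lambda>x. F 0 + integral {0..x} f) has_vector_derivative 0 + f x) (at x within {0..1})"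
    using assms by (intro has_vector_derivative_add integral_has_vector_derivative) auto
  then have "(F has_vector_derivative 0 + f x) (at x within {0..1})"
    by (rule has_vector_derivative_transform[rotated 2]) (use assms(3) in \<open>auto intro: has_L1_deriv_HK[OF assms(1)]\<close>)
  then show ?thesis by simp
qed

lemma has_L1_derivI:
  assumes "continuous_on {0..1} f"
    and "\<And>x. x \<in> {0..1} \<Longrightarrow> (F has_vector_derivative f x) (at x within {0..1})"
  shows "has_L1_deriv F f"
  unfolding has_L1_deriv_def
proof (intro conjI ballI)
  show int: "set_integrable lborel {0..1} f"
    by (rule borel_integrable_atLeastAtMost'[OF assms(1)])
  fix x :: real assume x: "x \<in> {0..1}"
  have "(f has_integral F x - F 0) {0..x}"
    using x by (intro fundamental_theorem_of_calculus)
      (auto intro: has_vector_derivative_within_subset[OF assms(2)])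
  moreover have "set_integrable lborel {0..x} f"
    by (rule set_integrable_subset[OF int]) (use x in auto)
  ultimately show "F x = F 0 + (LINT t:{0..x}|lborel. f t)"
    using set_borel_integral_eq_integral(2) by (metis add_diff_cancel_left' diff_add_cancel integral_unique)
qed

lemma has_L1_deriv_diff:
  assumes "has_L1_deriv F f" "has_L1_deriv G g"
  shows "has_L1_deriv (\<lambda>x. F x - G x) (\<lambda>x. f x - g x)"
  unfolding has_L1_deriv_def
proof (intro conjI ballI)
  show "set_integrable lborel {0..1} (\<lambda>x. f x - g x)"
    using assms unfolding has_L1_deriv_def by (intro set_integral_diff) auto
  fix x :: real assume x: "x \<in> {0..1}"
  have "set_integrable lborel {0..x} f" "set_integrable lborel {0..x} g"
    using assms x unfolding has_L1_deriv_def by (auto intro: set_integrable_subset)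
  then have "(LINT t:{0..x}|lborel. f t - g t) = (LINT t:{0..x}|lborel. f t) - (LINT t:{0..x}|lborel. g t)"
    by (rule set_integral_diff)
  moreover have "F x = F 0 + (LINT t:{0..x}|lborel. f t)" "G x = G 0 + (LINT t:{0..x}|lborel. g t)"
    using assms x unfolding has_L1_deriv_def by blast+
  ultimately show "F x - G x = F 0 - G 0 + (LINT t:{0..x}|lborel. f t - g t)"
    by simp
qed

lemma has_L1_deriv_cmult:
  assumes "has_L1_deriv F f"
  shows "has_L1_deriv (\<lambda>x. c * F x) (\<lambda>x. c * f x)"
  unfolding has_L1_deriv_def
proof (intro conjI ballI)
  show "set_integrable lborel {0..1} (\<lambda>x. c * f x)"
    using assms unfolding has_L1_deriv_def by (intro set_integrable_mult_right) auto
  fix x :: real assume x: "x \<in> {0..1}"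
  then have "F x = F 0 + (LINT t:{0..x}|lborel. f t)"
    using assms unfolding has_L1_deriv_def by blast
  then show "c * F x = c * F 0 + (LINT t:{0..x}|lborel. c * f t)"
    by (simp add: algebra_simps)
qed

lemma has_L1_deriv_sum:
  assumes "\<And>i. i \<in> S \<Longrightarrow> has_L1_deriv (F i) (f i)"
  shows "has_L1_deriv (\<lambda>x. \<Sum>i\<in>S. F i x) (\<lambda>x. \<Sum>i\<in>S. f i x)"
proof (cases "finite S")
  case True
  then show ?thesis using assms
  proof (induction S)
    case empty
    show ?case by (simp add: has_L1_deriv_def set_integrable_def set_lebesgue_integral_def)
  next
    case (insert i S)
    have "has_L1_deriv (\<lambda>x. F i x - (-1) * (\<Sum>i\<in>S. F i x)) (\<lambda>x. f i x - (-1) * (\<Sum>i\<in>S. f i x))"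
      using insert by (intro has_L1_deriv_diff has_L1_deriv_cmult) auto
    then show ?case using insert by simp
  qed
qed (simp add: has_L1_deriv_def set_integrable_def set_lebesgue_integral_def)

lemma set_integrable_continuous_mult:
  assumes "continuous_on {0..1} F" "set_integrable lborel {0..1::real} f"
  shows "set_integrable lborel {0..1} (\<lambda>x. F x * f x :: real)"
proof -
  have "bounded (F ` {0..1})"
    by (intro compact_imp_bounded compact_continuous_image assms) auto
  then obtain b where "\<forall>y\<in>F ` {0..1}. norm y \<le> b"
    unfolding bounded_iff by blast
  then have b: "\<bar>F x\<bar> \<le> b" if "x \<in> {0..1}" for x using that by simp
  have F: "(\<lambda>x. indicator {0..1} x *\<^sub>R F x) \<in> borel_measurable lborel"
    using assms(1) by (intro borel_measurable_integrable borel_integrable_atLeastAtMost'[unfolded set_integrable_def])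
  have f: "(\<lambda>x. indicator {0..1} x *\<^sub>R f x) \<in> borel_measurable lborel"
    using assms(2) unfolding set_integrable_def by (rule borel_measurable_integrable)
  have "integrable lborel (\<lambda>x. (indicator {0..1} x *\<^sub>R F x) * (indicator {0..1} x *\<^sub>R f x))"
  proof (rule Bochner_Integration.integrable_bound)
    show "integrable lborel (\<lambda>x. b * (indicator {0..1} x *\<^sub>R f x))"
      using assms(2) unfolding set_integrable_def by (intro integrable_mult_right)
    show "(\<lambda>x. (indicator {0..1} x *\<^sub>R F x) * (indicator {0..1} x *\<^sub>R f x)) \<in> borel_measurable lborel"
      by (rule borel_measurable_times[OF F f])
    have "\<bar>F x\<bar> * \<bar>f x\<bar> \<le> \<bar>b\<bar> * \<bar>f x\<bar>" if "x \<in> {0..1}" for x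
      using b[OF that] by (intro mult_right_mono) auto
    then show "AE x in lborel. norm ((indicator {0..1} x *\<^sub>R F x) * (indicator {0..1} x *\<^sub>R f x))
        \<le> norm (b * (indicator {0..1} x *\<^sub>R f x))"
      by (intro AE_I2) (auto simp: indicator_def abs_mult)
  qed
  then show ?thesis
    unfolding set_integrable_def by (rule back_subst[of "integrable lborel"]) (auto simp: indicator_def)
qed

text \<open>The factors need not be differentiable at every point, so instead of applying the product rule,
\<open>F x - F 0\<close> is written as \<open>\<integral> f t [t \<le> x] dt\<close>, and exchanging the order of integration in the double
integral of \<open>f t g x [t \<le> x]\<close> turns the cut-off of \<open>f\<close> from the left into a cut-off of \<open>g\<close> from
the right, whose integral is \<open>G 1 - G t\<close>.\<close>

lemma integral_by_parts_L1:
  assumes F: "has_L1_deriv F f" and G: "has_L1_deriv G g"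
  shows "(LINT x:{0..1}|lborel. F x * g x) = F 1 * G 1 - F 0 * G 0 - (LINT x:{0..1}|lborel. f x * G x)"
proof -
  define f' where "f' t = indicator {0..1} t *\<^sub>R f t" for t :: real
  define g' where "g' t = indicator {0..1} t *\<^sub>R g t" for t :: real
  define H where "H t x = f' t * g' x * (if t \<le> x then 1 else 0)" for t x
  have f': "integrable lborel f'" and g': "integrable lborel g'"
    using F G unfolding has_L1_deriv_def f'_def g'_def set_integrable_def by auto
  have [measurable]: "f' \<in> borel_measurable borel" "g' \<in> borel_measurable borel"
    using f' g' by (auto dest: borel_measurable_integrable)
  have cut_f: "F x - F 0 = (\<integral>t. f' t * (if t \<le> x then 1 else 0) \<partial>lborel)"
   and cut_g: "G x - G 0 = (\<integral>t. g' t * (if t \<le> x then 1 else 0) \<partial>lborel)" if "x \<in> {0..1}" for x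
  proof -
    have "F x - F 0 = (LINT t:{0..x}|lborel. f t)" "G x - G 0 = (LINT t:{0..x}|lborel. g t)"
      using F G that unfolding has_L1_deriv_def by (metis add_diff_cancel_left')+
    then show "F x - F 0 = (\<integral>t. f' t * (if t \<le> x then 1 else 0) \<partial>lborel)"
        "G x - G 0 = (\<integral>t. g' t * (if t \<le> x then 1 else 0) \<partial>lborel)"
      unfolding set_lebesgue_integral_def f'_def g'_def using that
      by (auto intro!: Bochner_Integration.integral_cong simp: indicator_def)
  qed
  have F1: "(\<integral>t. f' t \<partial>lborel) = F 1 - F 0" and G1: "(\<integral>t. g' t \<partial>lborel) = G 1 - G 0"
    unfolding cut_f[of 1, simplified] cut_g[of 1, simplified]
    by (auto intro!: Bochner_Integration.integral_cong simp: f'_def g'_def indicator_def)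
  have int_cut: "integrable lborel (\<lambda>x. g' x * (if x \<le> t then 1 else 0))"
    "integrable lborel (\<lambda>x. g' x * (if t \<le> x then 1 else 0))" for t
    by (rule Bochner_Integration.integrable_bound[OF g']; auto)+
  have tail_g: "(\<integral>x. g' x * (if t \<le> x then 1 else 0) \<partial>lborel) = G 1 - G t" if "t \<in> {0..1}" for t
  proof -
    have "(\<integral>x. g' x * (if x \<le> t then 1 else 0) \<partial>lborel) + (\<integral>x. g' x * (if t \<le> x then 1 else 0) \<partial>lborel)
        = (\<integral>x. g' x * (if x \<le> t then 1 else 0) + g' x * (if t \<le> x then 1 else 0) \<partial>lborel)"
      by (rule Bochner_Integration.integral_add[symmetric, OF int_cut])
    also have "\<dots> = (\<integral>x. g' x \<partial>lborel)"
    proof (rule integral_cong_AE)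
      show "AE x in lborel. g' x * (if x \<le> t then 1 else 0) + g' x * (if t \<le> x then 1 else 0) = g' x"
        using AE_lborel_singleton[of t] by eventually_elim auto
    qed measurable
    finally show ?thesis using G1 cut_g[OF that] by simp
  qed
  have H: "integrable (lborel \<Otimes>\<^sub>M lborel) (case_prod H)"
  proof -
    have "integrable (lborel \<Otimes>\<^sub>M lborel) (\<lambda>(t, x). f' t * g' x)"
    proof (rule lborel_pair.Fubini_integrable)
      show "(\<lambda>(t, x). f' t * g' x) \<in> borel_measurable (lborel \<Otimes>\<^sub>M lborel)" by measurable
      show "integrable lborel (\<lambda>t. \<integral>x. norm (case (t, x) of (t, x) \<Rightarrow> f' t * g' x) \<partial>lborel)"
        using f' g' by (simp add: abs_mult)
      show "AE t in lborel. integrable lborel (\<lambda>x. case (t, x) of (t, x) \<Rightarrow> f' t * g' x)"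
        using g' by simp
    qed
    then show ?thesis
    proof (rule Bochner_Integration.integrable_bound)
      show "case_prod H \<in> borel_measurable (lborel \<Otimes>\<^sub>M lborel)"
        unfolding H_def[abs_def] by measurable
    qed (auto simp: H_def)
  qed
  have "(LINT x:{0..1}|lborel. F x * g x) = (\<integral>x. F 0 * g' x + (\<integral>t. H t x \<partial>lborel) \<partial>lborel)"
    unfolding set_lebesgue_integral_def
  proof (rule Bochner_Integration.integral_cong[OF refl])
    fix x :: real
    show "indicator {0..1} x *\<^sub>R (F x * g x) = F 0 * g' x + (\<integral>t. H t x \<partial>lborel)"
    proof (cases "x \<in> {0..1}")
      case True
      have "(\<integral>t. H t x \<partial>lborel) = (\<integral>t. g' x * (f' t * (if t \<le> x then 1 else 0)) \<partial>lborel)"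
        by (simp add: H_def mult_ac)
      also have "\<dots> = g' x * (F x - F 0)" using cut_f[OF True] by simp
      finally show ?thesis using True by (simp add: g'_def algebra_simps)
    qed (simp add: H_def g'_def)
  qed
  also have "\<dots> = F 0 * (G 1 - G 0) + (\<integral>x. (\<integral>t. H t x \<partial>lborel) \<partial>lborel)"
    using g' lborel_pair.integrable_snd[OF H] G1 by simp
  also have "(\<integral>x. (\<integral>t. H t x \<partial>lborel) \<partial>lborel) = (\<integral>t. (\<integral>x. H t x \<partial>lborel) \<partial>lborel)"
    by (rule lborel_pair.Fubini_integral[OF H])
  finally have 1: "(LINT x:{0..1}|lborel. F x * g x)
      = F 0 * (G 1 - G 0) + (\<integral>t. (\<integral>x. H t x \<partial>lborel) \<partial>lborel)" .
  have "(LINT t:{0..1}|lborel. f t * G t) = (\<integral>t. G 1 * f' t - (\<integral>x. H t x \<partial>lborel) \<partial>lborel)"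
    unfolding set_lebesgue_integral_def
  proof (rule Bochner_Integration.integral_cong[OF refl])
    fix t :: real
    show "indicator {0..1} t *\<^sub>R (f t * G t) = G 1 * f' t - (\<integral>x. H t x \<partial>lborel)"
    proof (cases "t \<in> {0..1}")
      case True
      have "(\<integral>x. H t x \<partial>lborel) = (\<integral>x. f' t * (g' x * (if t \<le> x then 1 else 0)) \<partial>lborel)"
        by (simp add: H_def mult_ac)
      also have "\<dots> = f' t * (G 1 - G t)" using tail_g[OF True] by simp
      finally show ?thesis using True by (simp add: f'_def algebra_simps)
    qed (simp add: H_def f'_def)
  qed
  also have "\<dots> = G 1 * (F 1 - F 0) - (\<integral>t. (\<integral>x. H t x \<partial>lborel) \<partial>lborel)"
    using f' lborel_pair.integrable_fst[OF H] F1 by simp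
  finally show ?thesis using 1 by (simp add: algebra_simps)
qed

lemma L2_imp_L1:
  assumes "g \<in> borel_measurable lborel" "set_integrable lborel {0..1::real} (\<lambda>x. (g x :: real)\<^sup>2)"
  shows "set_integrable lborel {0..1} g"
proof -
  have "set_integrable lborel {0..1} (\<lambda>x. 1 + (g x)\<^sup>2)"
    using assms by (intro set_integral_add borel_integrable_atLeastAtMost'[of 0 1 "\<lambda>_. 1"]) auto
  then show ?thesis
  proof (rule set_integrable_bound)
    show "set_borel_measurable lborel {0..1} g"
      using assms unfolding set_borel_measurable_def by auto
    have "\<bar>y\<bar> \<le> \<bar>1 + y\<^sup>2\<bar>" for y :: real
      using sum_squares_bound[of 1 "\<bar>y\<bar>"] by simp
    then show "AE x in lborel. x \<in> {0..1} \<longrightarrow> norm (g x) \<le> norm (1 + (g x)\<^sup>2)"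
      by simp
  qed
qed

lemma nderiv_0 [simp]: "nderiv 0 \<phi> = \<phi>"
  by (simp add: nderiv_def)

lemma nderiv_Suc: "nderiv (Suc k) \<phi> x = vector_derivative (nderiv k \<phi>) (at x within {0..1})"
  by (simp add: nderiv_def)

lemma has_L2_deriv_chain:
  assumes \<phi>: "has_L2_deriv m \<phi> g" and k: "k < m"
  shows "has_L1_deriv (nderiv k \<phi>) (if Suc k = m then g else nderiv (Suc k) \<phi>)"
proof -
  have last: "has_L1_deriv (nderiv (m - 1) \<phi>) g"
    using \<phi> L2_imp_L1 unfolding has_L2_deriv_def has_L1_deriv_def by blast
  have diff: "\<And>k x. k < m - 1 \<Longrightarrow> x \<in> {0..1} \<Longrightarrow> nderiv k \<phi> differentiable (at x within {0..1})"
    using \<phi> unfolding has_L2_deriv_def by blast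
  show ?thesis
  proof (cases "Suc k = m")
    case True
    then show ?thesis using last by auto
  next
    case False
    have "continuous_on {0..1} (nderiv (Suc k) \<phi>)"
    proof (cases "Suc k = m - 1")
      case True
      then show ?thesis using has_L1_deriv_continuous[OF last] by simp
    next
      case neq: False
      then show ?thesis using diff[of "Suc k"] False k
        by (auto simp: continuous_on_eq_continuous_within intro!: differentiable_imp_continuous_within)
    qed
    moreover have "(nderiv k \<phi> has_vector_derivative nderiv (Suc k) \<phi> x) (at x within {0..1})" if "x \<in> {0..1}" for x
      unfolding nderiv_Suc using diff[of k x] that False k by (subst vector_derivative_works[symmetric]) auto
    ultimately show ?thesis using False by (auto intro: has_L1_derivI)
  qed
qed

section \<open>Splines with equidistant nodes\<close>

definition trunc_power :: "nat \<Rightarrow> real \<Rightarrow> real \<Rightarrow> real" where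
  "trunc_power n a x = (if a \<le> x then (x - a) ^ n / fact n else 0)"

text \<open>The coefficients \<open>z\<close> describe the polynomial on the first mesh interval and \<open>c\<close> the jumps at the
inner nodes. The index \<open>n\<close> is the degree allowed by \<open>z 0\<close>; the jumps have degree \<open>n - 1\<close>. Indexing the
whole tower of antiderivatives by \<open>n\<close> makes differentiation the step from \<open>n\<close> to \<open>n - 1\<close> with
unchanged coefficients, and packing \<open>z\<close> into a power series makes the polynomial part the
\<open>n\<close>-th coefficient of \<open>z(t) exp(x t)\<close>, so that its values at the nodes can be found by
manipulating generating functions.\<close>

definition spline :: "real fps \<Rightarrow> (nat \<Rightarrow> real) \<Rightarrow> nat \<Rightarrow> nat \<Rightarrow> real \<Rightarrow> real" where
  "spline z c N n x = fps_nth (z * fps_exp x) n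
     - (\<Sum>\<beta>\<in>{1..<N}. c \<beta> * trunc_power (n - 1) (real \<beta> / real N) x)"

lemma trunc_power_measurable [measurable]: "trunc_power n a \<in> borel_measurable borel"
  unfolding trunc_power_def by measurable

lemma trunc_power_has_L1_deriv:
  assumes "0 \<le> a"
  shows "has_L1_deriv (trunc_power (Suc n) a) (trunc_power n a)"
  unfolding has_L1_deriv_def
proof (intro conjI ballI)
  have "set_integrable lborel {0..1} (\<lambda>x. (x - a) ^ n / fact n)"
    by (rule borel_integrable_atLeastAtMost') (intro continuous_intros, auto)
  then show int: "set_integrable lborel {0..1} (trunc_power n a)"
    by (rule set_integrable_bound) (auto simp: trunc_power_def set_borel_measurable_def)
  fix x :: real assume x: "x \<in> {0..1}"
  have "trunc_power (Suc n) a = (\<lambda>x. max 0 (x - a) ^ Suc n / fact (Suc n))"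
    by (auto simp: trunc_power_def fun_eq_iff max_def)
  then have cont: "continuous_on {0..x} (trunc_power (Suc n) a)"
    by (simp only:) (intro continuous_intros, auto)
  have der: "(trunc_power (Suc n) a has_vector_derivative trunc_power n a y) (at y)" if "y \<noteq> a" for y
  proof (cases "a < y")
    case True
    have "((\<lambda>x. (x - a) ^ Suc n / fact (Suc n)) has_real_derivative
        of_nat (Suc n) * (y - a) ^ n / fact (Suc n)) (at y)"
      by (rule derivative_eq_intros refl | simp)+
    also have "of_nat (Suc n) * (y - a) ^ n / fact (Suc n) = trunc_power n a y"
      using True by (simp add: trunc_power_def divide_simps)
    finally have "((\<lambda>x. (x - a) ^ Suc n / fact (Suc n)) has_vector_derivative trunc_power n a y) (at y)"
      by (simp add: has_real_derivative_iff_has_vector_derivative)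
    then show ?thesis
      by (rule has_vector_derivative_transform_within_open[of _ _ _ "{a<..}"])
        (use True in \<open>auto simp: trunc_power_def\<close>)
  next
    case False
    have "((\<lambda>x. 0) has_vector_derivative trunc_power n a y) (at y)"
      using that False by (simp add: trunc_power_def)
    then show ?thesis
      by (rule has_vector_derivative_transform_within_open[of _ _ _ "{..<a}"])
        (use that False in \<open>auto simp: trunc_power_def\<close>)
  qed
  have "(trunc_power n a has_integral trunc_power (Suc n) a x - trunc_power (Suc n) a 0) {0..x}"
    by (rule fundamental_theorem_of_calculus_strong[of "{a}"]) (use x cont der in auto)
  moreover have "set_integrable lborel {0..x} (trunc_power n a)"
    by (rule set_integrable_subset[OF int]) (use x in auto)
  ultimately have "(LINT t:{0..x}|lborel. trunc_power n a t) = trunc_power (Suc n) a x - trunc_power (Suc n) a 0"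
    using set_borel_integral_eq_integral(2) integral_unique by metis
  then show "trunc_power (Suc n) a x = trunc_power (Suc n) a 0 + (LINT t:{0..x}|lborel. trunc_power n a t)"
    by simp
qed

lemma fps_exp_nth_has_derivative:
  "((\<lambda>x. fps_nth (z * fps_exp x) (Suc n)) has_real_derivative fps_nth (z * fps_exp x) n) (at x)"
proof -
  have *: "((\<lambda>x. fps_nth z i * (x ^ (Suc n - i) / fact (Suc n - i))) has_real_derivative
      fps_nth z i * (if i \<le> n then x ^ (n - i) / fact (n - i) else 0)) (at x)" if "i \<le> Suc n" for i
  proof (cases "i \<le> n")
    case True
    then obtain k where k: "n = i + k" using le_Suc_ex by blast
    have "((\<lambda>x. fps_nth z i * (x ^ Suc k / fact (Suc k))) has_real_derivative
        fps_nth z i * (of_nat (Suc k) * x ^ k / fact (Suc k))) (at x)"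
      by (rule derivative_eq_intros refl | simp)+
    moreover have "of_nat (Suc k) * x ^ k / fact (Suc k) = x ^ k / fact k" for x :: real
      by (simp add: divide_simps)
    ultimately have "((\<lambda>x. fps_nth z i * (x ^ Suc k / fact (Suc k))) has_real_derivative
        fps_nth z i * (x ^ k / fact k)) (at x)" by (simp only:)
    then show ?thesis using k by (simp add: Suc_diff_le del: power_Suc fact_Suc)
  next
    case False
    then have "i = Suc n" using that by simp
    then show ?thesis by simp
  qed
  have "((\<lambda>x. \<Sum>i=0..Suc n. fps_nth z i * (x ^ (Suc n - i) / fact (Suc n - i))) has_real_derivative
      (\<Sum>i=0..Suc n. fps_nth z i * (if i \<le> n then x ^ (n - i) / fact (n - i) else 0))) (at x)"
    by (intro DERIV_sum *) auto
  moreover have "(\<Sum>i=0..Suc n. fps_nth z i * (if i \<le> n then x ^ (n - i) / fact (n - i) else 0))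
      = (\<Sum>i=0..n. fps_nth z i * (x ^ (n - i) / fact (n - i)))"
    by (simp cong: sum.cong_simp)
  ultimately show ?thesis unfolding fps_mult_nth fps_exp_nth by simp
qed

lemma fps_exp_nth_continuous: "continuous_on A (\<lambda>x::real. fps_nth (z * fps_exp x) n)"
  unfolding fps_mult_nth fps_exp_nth by (intro continuous_intros) auto

lemma spline_has_L1_deriv:
  assumes "n \<ge> 1"
  shows "has_L1_deriv (spline z c N (Suc n)) (spline z c N n)"
proof -
  have "has_L1_deriv (\<lambda>x. fps_nth (z * fps_exp x) (Suc n)) (\<lambda>x. fps_nth (z * fps_exp x) n)"
    using fps_exp_nth_has_derivative
    by (intro has_L1_derivI fps_exp_nth_continuous)
      (auto simp: has_real_derivative_iff_has_vector_derivative intro: has_vector_derivative_at_within)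
  moreover have "has_L1_deriv (\<lambda>x. \<Sum>\<beta>\<in>{1..<N}. c \<beta> * trunc_power (Suc n - 1) (real \<beta> / real N) x)
      (\<lambda>x. \<Sum>\<beta>\<in>{1..<N}. c \<beta> * trunc_power (n - 1) (real \<beta> / real N) x)"
    using assms trunc_power_has_L1_deriv[of "real \<beta> / real N" "n - 1" for \<beta>]
    by (intro has_L1_deriv_sum has_L1_deriv_cmult) auto
  ultimately show ?thesis
    unfolding spline_def[abs_def] by (rule has_L1_deriv_diff)
qed

lemma spline_continuous:
  assumes "n \<ge> 2"
  shows "continuous_on {0..1} (spline z c N n)"
  using has_L1_deriv_continuous[OF spline_has_L1_deriv[of "n - 1" z c N]] assms by simp

lemma spline_measurable: "spline z c N n \<in> borel_measurable borel"
proof -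
  have "(\<lambda>x. fps_nth (z * fps_exp x) n) \<in> borel_measurable borel"
    by (rule borel_measurable_continuous_onI[OF fps_exp_nth_continuous])
  then show ?thesis unfolding spline_def[abs_def] by measurable
qed

text \<open>Differentiability at the nodes comes for free from the integral representation: an indefinite
integral of a continuous function is differentiable everywhere.\<close>

lemma nderiv_spline:
  assumes "k + 2 \<le> n" "x \<in> {0..1}"
  shows "nderiv k (spline z c N n) x = spline z c N (n - k) x"
    and "k + 3 \<le> n \<Longrightarrow> nderiv k (spline z c N n) differentiable (at x within {0..1})"
proof -
  have der: "k + 3 \<le> n \<Longrightarrow> x \<in> {0..1} \<Longrightarrow>
      (spline z c N (n - k) has_vector_derivative spline z c N (n - Suc k) x) (at x within {0..1})" for k x
    using spline_has_L1_deriv[of "n - Suc k" z c N] spline_continuous[of "n - Suc k" z c N]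
    by (intro has_L1_deriv_imp_has_vector_derivative) (simp_all flip: Suc_diff_le)
  have eq: "k + 2 \<le> n \<Longrightarrow> x \<in> {0..1} \<Longrightarrow> nderiv k (spline z c N n) x = spline z c N (n - k) x" for k x
  proof (induction k arbitrary: x)
    case (Suc k)
    have "(nderiv k (spline z c N n) has_vector_derivative spline z c N (n - Suc k) x) (at x within {0..1})"
      using Suc by (intro has_vector_derivative_transform[OF _ _ der]) auto
    then show ?case unfolding nderiv_Suc
      using Suc.prems by (intro vector_derivative_within_closed_interval) auto
  qed simp
  show "nderiv k (spline z c N n) x = spline z c N (n - k) x" by (rule eq[OF assms])
  assume k: "k + 3 \<le> n"
  then have "(nderiv k (spline z c N n) has_vector_derivative spline z c N (n - Suc k) x) (at x within {0..1})"
    using assms(2) eq by (intro has_vector_derivative_transform[OF _ _ der]) auto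
  then show "nderiv k (spline z c N n) differentiable (at x within {0..1})"
    by (rule differentiableI_vector)
qed

lemma spline_has_L2_deriv:
  assumes "m \<ge> 2"
  shows "has_L2_deriv m (spline z c N (2 * m)) (spline z c N m)"
  unfolding has_L2_deriv_def
proof (intro conjI allI impI ballI)
  show "spline z c N m \<in> borel_measurable lborel"
    using spline_measurable by simp
  show "set_integrable lborel {0..1} (\<lambda>x. (spline z c N m x)\<^sup>2)"
    by (intro borel_integrable_atLeastAtMost' continuous_intros spline_continuous assms)
  fix x :: real assume x: "x \<in> {0..1}"
  show "nderiv k (spline z c N (2 * m)) differentiable at x within {0..1}" if "k < m - 1" for k
    using that x by (intro nderiv_spline) auto
  have eq: "nderiv (m - 1) (spline z c N (2 * m)) y = spline z c N (Suc m) y" if "y \<in> {0..1}" for y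
  proof -
    have "2 * m - (m - 1) = Suc m" using assms by simp
    then show ?thesis using nderiv_spline(1)[of "m - 1" "2 * m" y z c N] that assms by simp
  qed
  have "spline z c N (Suc m) x = spline z c N (Suc m) 0 + (LINT t:{0..x}|lborel. spline z c N m t)"
    by (rule has_L1_derivD[OF spline_has_L1_deriv x]) (use assms in simp)
  moreover have "nderiv (m - 1) (spline z c N (2 * m)) 0 = spline z c N (Suc m) 0" by (rule eq) simp
  ultimately show "nderiv (m - 1) (spline z c N (2 * m)) x
      = nderiv (m - 1) (spline z c N (2 * m)) 0 + (LINT t:{0..x}|lborel. spline z c N m t)"
    unfolding eq[OF x] by linarith
qed

lemma set_integral_sum:
  fixes f :: "'i \<Rightarrow> 'a \<Rightarrow> real"
  assumes "\<And>i. i \<in> S \<Longrightarrow> set_integrable M A (f i)"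
  shows "set_integrable M A (\<lambda>x. \<Sum>i\<in>S. f i x)"
    and "(LINT x:A|M. (\<Sum>i\<in>S. f i x)) = (\<Sum>i\<in>S. (LINT x:A|M. f i x))"
  using assms unfolding set_integrable_def set_lebesgue_integral_def
  by (simp_all add: scaleR_sum_right del: real_scaleR_def)

lemma integral_tail:
  assumes "has_L1_deriv F f" "a \<in> {0..1}"
  shows "(LINT x:{0..1}|lborel. f x * trunc_power 0 a x) = F 1 - F a"
    and "set_integrable lborel {0..1} (\<lambda>x. f x * trunc_power 0 a x)"
proof -
  have f: "set_integrable lborel {0..1} f" using assms(1) unfolding has_L1_deriv_def by blast
  have fa: "set_integrable lborel {0..a} f" "set_integrable lborel {a..1} f"
    using f assms(2) by (auto intro: set_integrable_subset)
  have eq: "indicator {0..1} x *\<^sub>R (f x * trunc_power 0 a x) = indicator {a..1} x *\<^sub>R f x" for x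
    using assms(2) by (auto simp: trunc_power_def indicator_def)
  show "set_integrable lborel {0..1} (\<lambda>x. f x * trunc_power 0 a x)"
    using fa(2) unfolding set_integrable_def eq .
  have "(LINT x:{0..1}|lborel. f x * trunc_power 0 a x) = (LINT x:{a..1}|lborel. f x)"
    unfolding set_lebesgue_integral_def eq ..
  also have "\<dots> = integral {a..1} f" by (rule set_borel_integral_eq_integral(2)[OF fa(2)])
  also have "\<dots> = integral {0..1} f - integral {0..a} f"
    using Henstock_Kurzweil_Integration.integral_combine[of 0 a 1 f] assms(2)
      set_borel_integral_eq_integral(1)[OF f] by simp
  also have "\<dots> = F 1 - F a"
    using has_L1_deriv_HK[OF assms(1), of 1] has_L1_deriv_HK[OF assms(1), of a] assms(2) by simp
  finally show "(LINT x:{0..1}|lborel. f x * trunc_power 0 a x) = F 1 - F a" .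
qed

text \<open>Integration by parts moves all derivatives from \<open>\<phi>\<close> to the spline. The boundary values vanish until
level 2, where they produce the terms with \<open>\<phi>'\<close>; the spline of level 1 is piecewise linear with slope
\<open>z 0\<close>, and its jumps at the inner nodes produce the point values of \<open>\<phi>\<close>.\<close>

lemma spline_integral_by_parts:
  assumes m: "m \<ge> 2" and N: "N \<ge> 1"
    and \<phi>: "has_L2_deriv m \<phi> g"
    and bdry: "\<And>n. n \<in> {3..m} \<Longrightarrow> spline z c N n 0 = 0 \<and> spline z c N n 1 = 0"
  shows "(LINT x:{0..1}|lborel. spline z c N m x * g x) = (-1) ^ m *
     (spline z c N 2 1 * nderiv 1 \<phi> 1 - spline z c N 2 0 * nderiv 1 \<phi> 0
      - fps_nth z 0 * (\<phi> 1 - (LINT x:{0..1}|lborel. \<phi> x)) - fps_nth z 1 * (\<phi> 1 - \<phi> 0)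
      + (\<Sum>\<beta>\<in>{1..<N}. c \<beta> * (\<phi> 1 - \<phi> (real \<beta> / real N))))"
proof -
  define u where "u k = (if k = m then g else nderiv k \<phi>)" for k
  define I where "I k = (LINT x:{0..1}|lborel. spline z c N k x * u k x)" for k
  have u: "has_L1_deriv (u k) (u (Suc k))" if "k < m" for k
    using has_L2_deriv_chain[OF \<phi> that] that by (simp add: u_def)
  have parts: "I (Suc k) = spline z c N (Suc k) 1 * u k 1 - spline z c N (Suc k) 0 * u k 0
      - (LINT x:{0..1}|lborel. spline z c N k x * u k x)" if "1 \<le> k" "k < m" for k
    unfolding I_def using that by (intro integral_by_parts_L1 spline_has_L1_deriv u)
  have I: "I k = (-1) ^ k * I 2" if "2 \<le> k" "k \<le> m" for k
    using that
  proof (induction k rule: dec_induct)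
    case (step k)
    then show ?case using parts[of k] bdry[of "Suc k"] by (simp add: I_def)
  qed simp
  have "I m = (-1) ^ m * I 2" by (rule I[OF m order_refl])
  also have "I 2 = spline z c N 2 1 * u 1 1 - spline z c N 2 0 * u 1 0
      - (LINT x:{0..1}|lborel. spline z c N 1 x * u 1 x)"
    using parts[of 1] m by (simp add: numeral_2_eq_2)
  also have "u 1 = nderiv 1 \<phi>" using m by (simp add: u_def)
  also have "(LINT x:{0..1}|lborel. spline z c N 1 x * nderiv 1 \<phi> x)
      = fps_nth z 0 * (\<phi> 1 - (LINT x:{0..1}|lborel. \<phi> x)) + fps_nth z 1 * (\<phi> 1 - \<phi> 0)
      - (\<Sum>\<beta>\<in>{1..<N}. c \<beta> * (\<phi> 1 - \<phi> (real \<beta> / real N)))"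
  proof -
    have \<phi>1: "has_L1_deriv \<phi> (nderiv 1 \<phi>)"
      using u[of 0] m by (simp add: u_def)
    define P where "P x = fps_nth z 0 * x + fps_nth z 1" for x
    have P: "has_L1_deriv P (\<lambda>_. fps_nth z 0)"
      unfolding P_def by (intro has_L1_derivI continuous_intros) (auto intro!: derivative_eq_intros)
    have spl: "spline z c N 1 x = P x - (\<Sum>\<beta>\<in>{1..<N}. c \<beta> * trunc_power 0 (real \<beta> / real N) x)" for x
      by (simp add: spline_def P_def fps_mult_nth)
    have i1: "set_integrable lborel {0..1} (\<lambda>x. P x * nderiv 1 \<phi> x)"
      by (rule set_integrable_continuous_mult[OF has_L1_deriv_continuous[OF P] has_L1_deriv_integrable[OF \<phi>1]])
    have knot: "real \<beta> / real N \<in> {0..1}" if "\<beta> \<in> {1..<N}" for \<beta>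
      using that by simp
    have i2: "set_integrable lborel {0..1} (\<lambda>x. c \<beta> * (nderiv 1 \<phi> x * trunc_power 0 (real \<beta> / real N) x))"
      if "\<beta> \<in> {1..<N}" for \<beta>
      using integral_tail(2)[OF \<phi>1 knot[OF that]] by (intro set_integrable_mult_right) auto
    have "(LINT x:{0..1}|lborel. spline z c N 1 x * nderiv 1 \<phi> x)
       = (LINT x:{0..1}|lborel. P x * nderiv 1 \<phi> x
           - (\<Sum>\<beta>\<in>{1..<N}. c \<beta> * (nderiv 1 \<phi> x * trunc_power 0 (real \<beta> / real N) x)))"
      unfolding spl left_diff_distrib sum_distrib_right by (simp only: mult_ac)
    also have "\<dots> = (LINT x:{0..1}|lborel. P x * nderiv 1 \<phi> x)
        - (LINT x:{0..1}|lborel. \<Sum>\<beta>\<in>{1..<N}. c \<beta> * (nderiv 1 \<phi> x * trunc_power 0 (real \<beta> / real N) x))"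
      using i1 i2 by (intro set_integral_diff set_integral_sum) auto
    also have "(LINT x:{0..1}|lborel. \<Sum>\<beta>\<in>{1..<N}. c \<beta> * (nderiv 1 \<phi> x * trunc_power 0 (real \<beta> / real N) x))
        = (\<Sum>\<beta>\<in>{1..<N}. (LINT x:{0..1}|lborel. c \<beta> * (nderiv 1 \<phi> x * trunc_power 0 (real \<beta> / real N) x)))"
      using i2 by (intro set_integral_sum(2)) auto
    also have "\<dots> = (\<Sum>\<beta>\<in>{1..<N}. c \<beta> * (\<phi> 1 - \<phi> (real \<beta> / real N)))"
      using integral_tail(1)[OF \<phi>1 knot] by (intro sum.cong refl) simp
    also have "(LINT x:{0..1}|lborel. P x * nderiv 1 \<phi> x)
        = P 1 * \<phi> 1 - P 0 * \<phi> 0 - (LINT x:{0..1}|lborel. fps_nth z 0 * \<phi> x)"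
      by (rule integral_by_parts_L1[OF P \<phi>1])
    finally show ?thesis by (simp add: P_def algebra_simps)
  qed
  finally show ?thesis unfolding I_def u_def by (simp add: algebra_simps)
qed

section \<open>Null splines and the norm of the optimal error functional\<close>

text \<open>The square of \<open>f - c g\<close> has a nonnegative integral; \<open>c = \<integral> f g\<close> is the best choice for normalised \<open>g\<close>.\<close>

lemma L2_Cauchy_Schwarz:
  fixes f g :: "real \<Rightarrow> real"
  assumes [measurable]: "f \<in> borel_measurable lborel" "g \<in> borel_measurable lborel"
    and f: "set_integrable lborel {0..1} (\<lambda>x. (f x)\<^sup>2)"
    and g: "set_integrable lborel {0..1} (\<lambda>x. (g x)\<^sup>2)" "(LINT x:{0..1}|lborel. (g x)\<^sup>2) = 1"
  shows "(LINT x:{0..1}|lborel. f x * g x)\<^sup>2 \<le> (LINT x:{0..1}|lborel. (f x)\<^sup>2)"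
proof -
  define c where "c = (LINT x:{0..1}|lborel. f x * g x)"
  have fg: "set_integrable lborel {0..1} (\<lambda>x. f x * g x)"
  proof (rule set_integrable_bound)
    show "set_integrable lborel {0..1} (\<lambda>x. (f x)\<^sup>2 + (g x)\<^sup>2)"
      using f g by (intro set_integral_add)
    show "set_borel_measurable lborel {0..1} (\<lambda>x. f x * g x)"
      unfolding set_borel_measurable_def by measurable
    have "\<bar>a * b\<bar> \<le> a\<^sup>2 + b\<^sup>2" for a b :: real
    proof -
      have "2 * (\<bar>a\<bar> * \<bar>b\<bar>) \<le> a\<^sup>2 + b\<^sup>2" using sum_squares_bound[of "\<bar>a\<bar>" "\<bar>b\<bar>"] by simp
      moreover have "0 \<le> \<bar>a\<bar> * \<bar>b\<bar>" by simp
      ultimately show ?thesis unfolding abs_mult by linarith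
    qed
    then show "AE x in lborel. x \<in> {0..1} \<longrightarrow> norm (f x * g x) \<le> norm ((f x)\<^sup>2 + (g x)\<^sup>2)"
      by (simp only: real_norm_def) (auto simp: abs_of_nonneg)
  qed
  have "0 \<le> (LINT x:{0..1}|lborel. (f x - c * g x)\<^sup>2)"
    unfolding set_lebesgue_integral_def by (intro Bochner_Integration.integral_nonneg) simp
  also have "\<dots> = (LINT x:{0..1}|lborel. ((f x)\<^sup>2 + c\<^sup>2 * (g x)\<^sup>2) - (2 * c) * (f x * g x))"
    by (simp add: power2_diff power_mult_distrib algebra_simps)
  also have "\<dots> = (LINT x:{0..1}|lborel. (f x)\<^sup>2) + c\<^sup>2 * 1 - (2 * c) * c"
    using f g fg by (simp add: set_integral_diff(2) set_integral_diff(1) set_integral_add(1) set_integral_add(2) c_def)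
  finally show ?thesis unfolding c_def[symmetric] by (simp add: power2_eq_square)
qed

text \<open>The conditions that characterise the extremal function \<open>\<psi> = spline z c N (2 * m)\<close>: it vanishes at all
nodes and has vanishing derivative at both ends, so that every quadrature sum of \<open>\<psi>\<close> is zero;
and its \<open>m\<close>-th derivative meets zero at both ends to the order that a Peano kernel of a
formula with first derivatives at the ends must have.\<close>

definition null_spline :: "nat \<Rightarrow> nat \<Rightarrow> real fps \<Rightarrow> (nat \<Rightarrow> real) \<Rightarrow> bool" where
  "null_spline m N z c \<longleftrightarrow>
     (\<forall>n\<in>{3..m} \<union> {2 * m - 1}. spline z c N n 0 = 0 \<and> spline z c N n 1 = 0) \<and>
     (\<forall>\<beta>\<le>N. spline z c N (2 * m) (real \<beta> / real N) = 0)"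

text \<open>If the spline is moreover a null spline, this formula is optimal; see the proof of
\<open>optimal_error_norm\<close> below. The prescribed \<open>z 0\<close> normalises the
\<open>m\<close>-th derivative of the kernel to \<open>(-1)^m\<close>, which is what gives \<open>\<integral> \<phi>\<close> the coefficient 1.\<close>

lemma spline_peano_kernel:
  assumes m: "m \<ge> 2" and N: "N \<ge> 1" and z: "fps_nth z 0 = (-1) ^ m"
    and bdry: "\<And>n. n \<in> {3..m} \<Longrightarrow> spline z c N n 0 = 0 \<and> spline z c N n 1 = 0"
  obtains C A B where "\<And>\<phi> g. has_L2_deriv m \<phi> g \<Longrightarrow>
      quad_error N C A B \<phi> = (LINT x:{0..1}|lborel. spline z c N m x * g x)"
proof
  define e :: real where "e = (-1) ^ m"
  \<comment> \<open>The inner coefficients are the jumps; those at the ends collect the remaining point values.\<close>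
  define C where "C \<beta> = (if \<beta> = 0 then - e * fps_nth z 1
      else if \<beta> = N then e * (e + fps_nth z 1 - (\<Sum>\<beta>\<in>{1..<N}. c \<beta>)) else e * c \<beta>)" for \<beta>
  fix \<phi> g assume \<phi>: "has_L2_deriv m \<phi> g"
  have ee: "e * e = 1" by (simp add: e_def flip: power_mult_distrib)
  have "{0..N} = insert 0 (insert N {1..<N})" using N by auto
  then have "(\<Sum>\<beta>=0..N. C \<beta> * \<phi> (1 / real N * real \<beta>))
      = C 0 * \<phi> 0 + C N * \<phi> 1 + (\<Sum>\<beta>\<in>{1..<N}. C \<beta> * \<phi> (real \<beta> / real N))"
    using N by simp
  also have "(\<Sum>\<beta>\<in>{1..<N}. C \<beta> * \<phi> (real \<beta> / real N)) = e * (\<Sum>\<beta>\<in>{1..<N}. c \<beta> * \<phi> (real \<beta> / real N))"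
    unfolding sum_distrib_left by (intro sum.cong refl) (auto simp: C_def)
  finally have "(\<Sum>\<beta>=0..N. C \<beta> * \<phi> (1 / real N * real \<beta>)) = - e * fps_nth z 1 * \<phi> 0
      + e * (e + fps_nth z 1 - (\<Sum>\<beta>\<in>{1..<N}. c \<beta>)) * \<phi> 1 + e * (\<Sum>\<beta>\<in>{1..<N}. c \<beta> * \<phi> (real \<beta> / real N))"
    using N by (simp add: C_def)
  moreover have "(\<Sum>\<beta>\<in>{1..<N}. c \<beta> * (\<phi> 1 - \<phi> (real \<beta> / real N)))
      = (\<Sum>\<beta>\<in>{1..<N}. c \<beta>) * \<phi> 1 - (\<Sum>\<beta>\<in>{1..<N}. c \<beta> * \<phi> (real \<beta> / real N))"
    by (simp add: right_diff_distrib sum_subtractf sum_distrib_right)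
  moreover have "(LINT x:{0..1}|lborel. spline z c N m x * g x) = (-1) ^ m *
     (spline z c N 2 1 * nderiv 1 \<phi> 1 - spline z c N 2 0 * nderiv 1 \<phi> 0
      - fps_nth z 0 * (\<phi> 1 - (LINT x:{0..1}|lborel. \<phi> x)) - fps_nth z 1 * (\<phi> 1 - \<phi> 0)
      + (\<Sum>\<beta>\<in>{1..<N}. c \<beta> * (\<phi> 1 - \<phi> (real \<beta> / real N))))"
    by (rule spline_integral_by_parts[OF m N \<phi>]) (rule bdry)
  ultimately show "quad_error N C (e * spline z c N 2 0) (- e * spline z c N 2 1) \<phi>
      = (LINT x:{0..1}|lborel. spline z c N m x * g x)"
    unfolding quad_error_def Let_def z e_def[symmetric]
    using ee by algebra
qed

text \<open>Since the second spline vanishes at all nodes, and its derivative at both ends, only its integral survives the integration by parts. It is evaluated with the antiderivative of level \<open>2 * m + 1\<close>.\<close>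

lemma null_spline_pairing:
  assumes m: "m \<ge> 2" and N: "N \<ge> 1"
    and z: "null_spline m N z c" and w: "null_spline m N w b"
  shows "(LINT x:{0..1}|lborel. spline z c N m x * spline w b N m x)
    = (-1) ^ m * fps_nth z 0 * (spline w b N (2 * m + 1) 1 - spline w b N (2 * m + 1) 0)"
proof -
  define \<psi> where "\<psi> = spline w b N (2 * m)"
  have knots: "\<psi> (real \<beta> / real N) = 0" if "\<beta> \<le> N" for \<beta>
    using w that unfolding null_spline_def \<psi>_def by blast
  have ends: "\<psi> 0 = 0" "\<psi> 1 = 0"
    using knots[of 0] knots[of N] N by auto
  have der: "nderiv 1 \<psi> 0 = 0" "nderiv 1 \<psi> 1 = 0"
    using w m nderiv_spline(1)[of 1 "2 * m" _ w b N] unfolding null_spline_def \<psi>_def by auto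
  have int: "(LINT x:{0..1}|lborel. \<psi> x) = spline w b N (2 * m + 1) 1 - spline w b N (2 * m + 1) 0"
    using has_L1_deriv_integral[OF spline_has_L1_deriv[of "2 * m" w b N]] m by (simp add: \<psi>_def)
  have sum0: "(\<Sum>\<beta>\<in>{1..<N}. c \<beta> * (\<psi> 1 - \<psi> (real \<beta> / real N))) = 0"
    using knots ends by (intro sum.neutral) auto
  have L2: "has_L2_deriv m \<psi> (spline w b N m)"
    unfolding \<psi>_def by (rule spline_has_L2_deriv[OF m])
  have "(LINT x:{0..1}|lborel. spline z c N m x * spline w b N m x) = (-1) ^ m *
     (spline z c N 2 1 * nderiv 1 \<psi> 1 - spline z c N 2 0 * nderiv 1 \<psi> 0
      - fps_nth z 0 * (\<psi> 1 - (LINT x:{0..1}|lborel. \<psi> x)) - fps_nth z 1 * (\<psi> 1 - \<psi> 0)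
      + (\<Sum>\<beta>\<in>{1..<N}. c \<beta> * (\<psi> 1 - \<psi> (real \<beta> / real N))))"
    using z unfolding null_spline_def by (intro spline_integral_by_parts[OF m N L2]) auto
  then show ?thesis unfolding sum0 int[symmetric] using ends der by simp
qed

lemma spline_scale: "spline (fps_const s * z) (\<lambda>\<beta>. s * c \<beta>) N n x = s * spline z c N n x"
  unfolding spline_def by (simp add: mult.assoc right_diff_distrib sum_distrib_left)

lemma quad_error_spline:
  assumes "m \<ge> 2" "N \<ge> 1" "null_spline m N z c"
  shows "quad_error N C A B (spline z c N (2 * m)) = spline z c N (2 * m + 1) 1 - spline z c N (2 * m + 1) 0"
proof -
  have "(\<Sum>\<beta>=0..N. C \<beta> * spline z c N (2 * m) (1 / real N * real \<beta>)) = 0"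
    using assms(3) unfolding null_spline_def by (intro sum.neutral) auto
  moreover have "nderiv 1 (spline z c N (2 * m)) 0 = 0" "nderiv 1 (spline z c N (2 * m)) 1 = 0"
    using assms nderiv_spline(1)[of 1 "2 * m" _ z c N] unfolding null_spline_def by auto
  moreover have "(LINT x:{0..1}|lborel. spline z c N (2 * m) x)
      = spline z c N (2 * m + 1) 1 - spline z c N (2 * m + 1) 0"
    using has_L1_deriv_integral[OF spline_has_L1_deriv[of "2 * m" z c N]] assms(1) by simp
  ultimately show ?thesis by (simp add: quad_error_def)
qed

text \<open>A supremum over the empty set would be \<open>-\<infinity>\<close>; the polynomial \<open>x ^ m / m!\<close> has norm 1.\<close>

lemma error_norm_nonneg:
  assumes "m \<ge> 2"
  shows "0 \<le> error_norm m N C A B"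
proof -
  let ?\<phi> = "spline (fps_X ^ m) (\<lambda>_. 0) N (2 * m)"
  have "spline (fps_X ^ m) (\<lambda>_. 0) N m = (\<lambda>_. 1)"
    by (simp add: spline_def fun_eq_iff fps_X_power_mult_nth)
  then have "has_L2_deriv m ?\<phi> (\<lambda>_. 1)"
    using spline_has_L2_deriv[OF assms] by metis
  then have "?\<phi> \<in> {\<phi> \<in> sobolev m. sobolev_norm m \<phi> = 1}"
    by (auto simp: sobolev_def sobolev_norm_eq set_lebesgue_integral_def)
  then have "ereal \<bar>quad_error N C A B ?\<phi>\<bar> \<le> error_norm m N C A B"
    unfolding error_norm_def by (rule SUP_upper)
  then show ?thesis by (rule order_trans[rotated]) simp
qed

text \<open>The kernel \<open>\<kappa> = \<psi>^(m)\<close> is the Peano kernel of one formula, whose error is therefore at most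
\<open>sqrt K\<close> with \<open>K = \<integral> \<kappa>\<^sup>2\<close>, by the Cauchy-Schwarz inequality. No formula can do better: every formula
assigns the value 0 to \<open>\<psi>\<close>, so its error at \<open>\<psi>\<close> is \<open>\<integral> \<psi> = K\<close>, while \<open>\<psi>\<close> has norm \<open>sqrt K\<close>. Hence the
optimal norm is \<open>sqrt K\<close>, even without knowing that the optimal coefficients are unique.\<close>

lemma optimal_error_norm:
  assumes m: "m \<ge> 2" and N: "N \<ge> 1" and opt: "optimal_quadrature m N C A B"
    and null: "null_spline m N z c" and z: "fps_nth z 0 = (-1) ^ m"
  shows "(real_of_ereal (error_norm m N C A B))\<^sup>2
    = spline z c N (2 * m + 1) 1 - spline z c N (2 * m + 1) 0"
proof -
  define \<kappa> where "\<kappa> = spline z c N m"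
  define K where "K = (LINT x:{0..1}|lborel. (\<kappa> x)\<^sup>2)"
  have K: "K = spline z c N (2 * m + 1) 1 - spline z c N (2 * m + 1) 0"
    using null_spline_pairing[OF m N null null] z
    by (simp add: K_def \<kappa>_def power2_eq_square flip: power_mult_distrib)
  have "0 \<le> K"
    unfolding K_def set_lebesgue_integral_def by (intro Bochner_Integration.integral_nonneg) simp
  obtain C' A' B' where peano: "\<And>\<phi> g. has_L2_deriv m \<phi> g \<Longrightarrow>
      quad_error N C' A' B' \<phi> = (LINT x:{0..1}|lborel. \<kappa> x * g x)"
    using spline_peano_kernel[OF m N z, of c] null unfolding null_spline_def \<kappa>_def by auto
  have "error_norm m N C' A' B' \<le> ereal (sqrt K)"
    unfolding error_norm_def
  proof (rule SUP_least)
    fix \<phi> assume "\<phi> \<in> {\<phi> \<in> sobolev m. sobolev_norm m \<phi> = 1}"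
    then obtain g where g: "has_L2_deriv m \<phi> g" and norm: "sobolev_norm m \<phi> = 1"
      by (auto simp: sobolev_def)
    have "(LINT x:{0..1}|lborel. (g x)\<^sup>2) = 1"
      using norm sobolev_norm_eq[OF g] by simp
    then have "(quad_error N C' A' B' \<phi>)\<^sup>2 \<le> K"
      unfolding peano[OF g] K_def
      using g spline_has_L2_deriv[OF m, of z c N] unfolding has_L2_deriv_def \<kappa>_def
      by (intro L2_Cauchy_Schwarz) auto
    then show "ereal \<bar>quad_error N C' A' B' \<phi>\<bar> \<le> ereal (sqrt K)"
      using real_sqrt_le_mono by fastforce
  qed
  then have upper: "error_norm m N C A B \<le> ereal (sqrt K)"
    using opt unfolding optimal_quadrature_def by (meson order_trans)
  have lower: "ereal (sqrt K) \<le> error_norm m N C A B"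
  proof (cases "K = 0")
    case True
    then show ?thesis using error_norm_nonneg[OF m, of N C A B] by (simp add: zero_ereal_def)
  next
    case False
    define s where "s = 1 / sqrt K"
    define w where "w = fps_const s * z"
    define b where "b = (\<lambda>\<beta>. s * c \<beta>)"
    have w: "spline w b N n x = s * spline z c N n x" for n x
      unfolding w_def b_def by (rule spline_scale)
    have "s\<^sup>2 * K = 1" using False \<open>0 \<le> K\<close> by (simp add: s_def power_divide)
    then have "(LINT x:{0..1}|lborel. (spline w b N m x)\<^sup>2) = 1"
      by (simp add: w K_def \<kappa>_def power_mult_distrib)
    then have "spline w b N (2 * m) \<in> {\<phi> \<in> sobolev m. sobolev_norm m \<phi> = 1}"
      using sobolev_norm_eq[OF spline_has_L2_deriv[OF m]] spline_has_L2_deriv[OF m]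
      unfolding sobolev_def by fastforce
    then have "ereal \<bar>quad_error N C A B (spline w b N (2 * m))\<bar> \<le> error_norm m N C A B"
      unfolding error_norm_def by (rule SUP_upper)
    moreover have "null_spline m N w b" using null by (simp add: null_spline_def w)
    ultimately have "ereal \<bar>s * K\<bar> \<le> error_norm m N C A B"
      by (simp add: quad_error_spline[OF m N] w K right_diff_distrib)
    moreover have "s * K = sqrt K" using \<open>0 \<le> K\<close> by (simp add: s_def real_div_sqrt)
    ultimately show ?thesis using \<open>0 \<le> K\<close> by simp
  qed
  from upper lower have "error_norm m N C A B = ereal (sqrt K)" by (rule antisym)
  then show ?thesis using \<open>0 \<le> K\<close> K by simp
qed

text \<open>The pairing of the two kernels, computed in both orders, is \<open>0\<close> times the integral of one spline and
\<open>1\<close> times the integral of the other.\<close>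

lemma null_spline_integral_eq_0:
  assumes m: "m \<ge> 2" and N: "N \<ge> 1"
    and z: "null_spline m N z c" "fps_nth z 0 = (-1) ^ m"
    and w: "null_spline m N w b" "fps_nth w 0 = 0"
  shows "spline w b N (2 * m + 1) 1 - spline w b N (2 * m + 1) 0 = 0"
proof -
  have "(LINT x:{0..1}|lborel. spline w b N m x * spline z c N m x) = 0"
    using null_spline_pairing[OF m N w(1) z(1)] w(2) by simp
  moreover have "(LINT x:{0..1}|lborel. spline z c N m x * spline w b N m x)
      = spline w b N (2 * m + 1) 1 - spline w b N (2 * m + 1) 0"
    using null_spline_pairing[OF m N z(1) w(1)] z(2) by (simp flip: power_mult_distrib)
  ultimately show ?thesis by (simp add: mult.commute)
qed

section \<open>Generating functions of exponential and Bernoulli splines\<close>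

text \<open>The generating function \<open>- r / (exp t - r)\<close>. For \<open>|r| < 1\<close> it is the formal sum of
\<open>- r^\<beta> exp(- \<beta> t)\<close> over \<open>\<beta> \<ge> 1\<close>, and its coefficients describe, near 0, the spline with jump
\<open>r^\<beta>\<close> at each integer \<open>\<beta>\<close> that is multiplied by \<open>r\<close> under translation by 1. Using the closed
form allows the parameters \<open>q\<close> and \<open>1 / q\<close> to be treated alike, without convergence.\<close>

definition apostol_fps :: "complex \<Rightarrow> complex fps" where
  "apostol_fps r = fps_const (- r) * inverse (fps_exp 1 - fps_const r)"

lemma apostol_fps_eq:
  assumes "r \<noteq> 1"
  shows "apostol_fps r * (fps_exp 1 - fps_const r) = - fps_const r"
proof -
  have "inverse (fps_exp 1 - fps_const r) * (fps_exp 1 - fps_const r) = 1"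
    by (rule inverse_mult_eq_1) (use assms in simp)
  then show ?thesis by (simp add: apostol_fps_def mult.assoc)
qed

lemma apostol_fps_eqI:
  assumes "r \<noteq> 1" "F * (fps_exp 1 - fps_const r) = - fps_const r"
  shows "F = apostol_fps r"
proof -
  have "fps_nth (fps_exp 1 - fps_const r) 0 \<noteq> 0" using assms(1) by simp
  then have "fps_exp 1 - fps_const r \<noteq> 0" by (metis fps_zero_nth)
  then show ?thesis using assms(2) apostol_fps_eq[OF assms(1)] by (metis mult_right_cancel)
qed

text \<open>The two generating functions satisfy \<open>A\<^bsub>1/r\<^esub>(-t) = 1 - A\<^bsub>r\<^esub>(t)\<close>. Consequently the roots of the Euler
polynomial come in pairs \<open>q\<close>, \<open>1 / q\<close>.\<close>

lemma apostol_fps_reflect: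
  assumes "r \<noteq> 0" "r \<noteq> 1" "j \<ge> 1"
  shows "fps_nth (apostol_fps (1 / r)) j = (-1) ^ (j + 1) * fps_nth (apostol_fps r) j"
proof -
  define R where "R = apostol_fps (1 / r) oo (- fps_X)"
  have "(apostol_fps (1 / r) * (fps_exp 1 - fps_const (1 / r))) oo (- fps_X) = (- fps_const (1 / r)) oo (- fps_X)"
    using apostol_fps_eq[of "1 / r"] assms by simp
  then have "R * (fps_exp (-1) - fps_const (1 / r)) = - fps_const (1 / r)"
    by (simp add: R_def fps_compose_mult_distrib fps_compose_sub_distrib fps_compose_uminus)
  then have "(R * (fps_exp (-1) - fps_const (1 / r))) * (fps_const r * fps_exp 1)
      = - fps_const (1 / r) * (fps_const r * fps_exp 1)" by simp
  moreover have "fps_exp (-1) * fps_exp 1 = (1 :: complex fps)"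
    by (simp flip: fps_exp_add_mult)
  moreover have "fps_const (1 / r) * fps_const r = 1" using assms by simp
  ultimately have "R * (fps_const r - fps_exp 1) = - fps_exp 1"
    by algebra
  then have "(1 - R) * (fps_exp 1 - fps_const r) = - fps_const r" by algebra
  then have "1 - R = apostol_fps r" by (rule apostol_fps_eqI[OF assms(2)])
  then have "fps_nth (1 - R) j = fps_nth (apostol_fps r) j" by simp
  then have "(-1) ^ j * fps_nth (apostol_fps (1 / r)) j = - fps_nth (apostol_fps r) j"
    using assms(3) by (simp add: R_def fps_compose_uminus' fps_nth_Abs_fps minus_equation_iff)
  then have "(-1) ^ j * ((-1) ^ j * fps_nth (apostol_fps (1 / r)) j) = (-1) ^ j * (- fps_nth (apostol_fps r) j)" by simp
  then show ?thesis by (simp flip: mult.assoc power_add power_mult_distrib)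
qed

lemma sum_from_1_Suc:
  fixes f :: "nat \<Rightarrow> 'a::comm_monoid_add"
  shows "(\<Sum>\<beta>=1..Suc b. f \<beta>) = f 1 + (\<Sum>\<beta>=1..b. f (Suc \<beta>))"
  by (simp add: sum.atLeast_Suc_atMost sum.shift_bounds_cl_Suc_ivl del: sum.cl_ivl_Suc)

text \<open>Translation by \<open>b\<close> mesh widths multiplies the exponential spline by \<open>r ^ b\<close>; the sum is exactly the
contribution of the jumps that are passed on the way.\<close>

lemma apostol_fps_shift:
  assumes "r \<noteq> 1"
  shows "apostol_fps r * fps_exp (of_nat b) = fps_const (r ^ b) * apostol_fps r
           - (\<Sum>\<beta>=1..b. fps_const (r ^ \<beta>) * fps_exp (of_nat (b - \<beta>)))"
proof (induction b)
  case (Suc b)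
  have 1: "apostol_fps r * fps_exp 1 = fps_const r * apostol_fps r - fps_const r"
    using apostol_fps_eq[OF assms] by (simp add: algebra_simps)
  have "apostol_fps r * fps_exp (of_nat (Suc b)) = apostol_fps r * fps_exp 1 * fps_exp (of_nat b)"
    by (simp add: fps_exp_add_mult mult.assoc)
  also have "\<dots> = fps_const r * (apostol_fps r * fps_exp (of_nat b)) - fps_const r * fps_exp (of_nat b)"
    unfolding 1 by (simp add: algebra_simps)
  also have "\<dots> = fps_const (r ^ Suc b) * apostol_fps r
      - (fps_const r * fps_exp (of_nat b)
         + (\<Sum>\<beta>=1..b. fps_const (r ^ Suc \<beta>) * fps_exp (of_nat (Suc b - Suc \<beta>))))"
    unfolding Suc by (simp add: algebra_simps sum_distrib_left flip: fps_const_mult)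
  also have "fps_const r * fps_exp (of_nat b)
         + (\<Sum>\<beta>=1..b. fps_const (r ^ Suc \<beta>) * fps_exp (of_nat (Suc b - Suc \<beta>)))
      = (\<Sum>\<beta>=1..Suc b. fps_const (r ^ \<beta>) * fps_exp (of_nat (Suc b - \<beta>)))"
    unfolding sum_from_1_Suc by simp
  finally show ?case .
qed simp

text \<open>The limiting case \<open>r = 1\<close>: \<open>bernoulli_fps * exp (x t)\<close> generates the Bernoulli polynomials, whose periodic
continuation is the spline with jump \<open>-1\<close> at every integer.\<close>

definition bernoulli_fps :: "complex fps" where
  "bernoulli_fps = Abs_fps (\<lambda>n. of_real (bernoulli_num n / fact n))"

lemma bernoulli_fps_eq: "bernoulli_fps * (fps_exp 1 - 1) = fps_X"
proof -
  have sd: "subdegree (fps_exp 1 - 1 :: real fps) = 1"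
    by (rule subdegreeI) auto
  have "fps_exp 1 - 1 dvd (fps_X :: real fps)"
    using sd by (subst fps_dvd_iff) auto
  then have *: "fps_X / (fps_exp 1 - 1) * (fps_exp 1 - 1) = (fps_X :: real fps)"
    by simp
  show ?thesis
  proof (rule fps_ext)
    fix n
    have "fps_nth (bernoulli_fps * (fps_exp 1 - 1)) n
        = of_real (fps_nth (fps_X / (fps_exp 1 - 1) * (fps_exp 1 - 1)) n)"
      unfolding fps_mult_nth of_real_sum
      by (intro sum.cong refl) (simp add: bernoulli_fps_def bernoulli_num_def)
    also have "\<dots> = fps_nth fps_X n" unfolding * by (simp add: fps_X_def)
    finally show "fps_nth (bernoulli_fps * (fps_exp 1 - 1)) n = fps_nth fps_X n" .
  qed
qed

lemma bernoulli_fps_shift: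
  "bernoulli_fps * fps_exp (of_nat b) = bernoulli_fps + fps_X * (\<Sum>\<beta>=1..b. fps_exp (of_nat (b - \<beta>)))"
proof (induction b)
  case (Suc b)
  have 1: "bernoulli_fps * fps_exp 1 = bernoulli_fps + fps_X"
    using bernoulli_fps_eq by (simp add: algebra_simps)
  have "bernoulli_fps * fps_exp (of_nat (Suc b)) = bernoulli_fps * fps_exp 1 * fps_exp (of_nat b)"
    by (simp add: fps_exp_add_mult mult.assoc)
  also have "\<dots> = bernoulli_fps + fps_X * (fps_exp (of_nat b) + (\<Sum>\<beta>=1..b. fps_exp (of_nat (Suc b - Suc \<beta>))))"
    unfolding 1 by (simp add: distrib_right Suc) (simp add: algebra_simps)
  also have "fps_exp (of_nat b) + (\<Sum>\<beta>=1..b. fps_exp (of_nat (Suc b - Suc \<beta>)))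
      = (\<Sum>\<beta>=1..Suc b. fps_exp (of_nat (Suc b - \<beta>)) :: complex fps)"
    unfolding sum_from_1_Suc by simp
  finally show ?case .
qed simp

lemma bernoulli_fps_nth_0: "fps_nth bernoulli_fps 0 = 1"
proof -
  have "fps_nth (bernoulli_fps * (fps_exp 1 - 1)) 1 = 1" unfolding bernoulli_fps_eq by simp
  then show ?thesis by (simp add: fps_mult_nth)
qed

text \<open>With \<open>f(t) = t / (exp t - 1)\<close> one has \<open>f(-t) = f(t) + t\<close>.\<close>

lemma bernoulli_num_odd:
  assumes "odd n" "n \<ge> 3"
  shows "bernoulli_num n = 0"
proof -
  define R where "R = bernoulli_fps oo (- fps_X)"
  have "(bernoulli_fps * (fps_exp 1 - 1)) oo (- fps_X) = fps_X oo (- fps_X)"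
    by (simp add: bernoulli_fps_eq)
  then have "R * (fps_exp (-1) - 1) = - fps_X"
    by (simp add: R_def fps_compose_mult_distrib fps_compose_sub_distrib)
  moreover have "fps_exp (-1) * fps_exp 1 = (1 :: complex fps)"
    by (simp flip: fps_exp_add_mult)
  ultimately have "R * (fps_exp 1 - 1) = fps_X * fps_exp 1" by algebra
  moreover have "(bernoulli_fps + fps_X) * (fps_exp 1 - 1) = fps_X * fps_exp 1"
    unfolding distrib_right bernoulli_fps_eq by (simp add: algebra_simps)
  moreover have "fps_exp 1 - 1 \<noteq> (0 :: complex fps)"
    by (metis bernoulli_fps_eq fps_X_neq_zero mult_zero_right)
  ultimately have "R = bernoulli_fps + fps_X" by (metis mult_right_cancel)
  then have "fps_nth R n = fps_nth (bernoulli_fps + fps_X) n" by simp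
  then have "fps_nth bernoulli_fps n = 0"
    using assms by (simp add: R_def fps_compose_uminus' fps_nth_Abs_fps)
  then show ?thesis by (simp add: bernoulli_fps_def)
qed

text \<open>The difference operator acts on \<open>exp(x t)\<close> as multiplication by \<open>exp t - 1\<close>. This identifies
\<open>\<Delta>^i 0^j / j!\<close> with the coefficients of \<open>(exp t - 1)^i\<close>, and so connects the sums in the linear
system with generating functions.\<close>

lemma exp_diff_power_nth:
  "fps_nth ((fps_exp 1 - 1) ^ i * fps_exp (of_real x)) j
     = (of_real ((fwd_diff ^^ i) (\<lambda>\<gamma>. \<gamma> ^ j) x / fact j) :: complex)"
proof (induction i arbitrary: x)
  case (Suc i)
  have "(fps_exp 1 - 1) ^ Suc i * fps_exp (of_real x :: complex)
      = (fps_exp 1 - 1) ^ i * fps_exp (of_real (x + 1)) - (fps_exp 1 - 1) ^ i * fps_exp (of_real x)"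
    by (simp add: fps_exp_add_mult algebra_simps)
  then have "fps_nth ((fps_exp 1 - 1) ^ Suc i * fps_exp (of_real x :: complex)) j
      = of_real ((fwd_diff ^^ i) (\<lambda>\<gamma>. \<gamma> ^ j) (x + 1) / fact j)
        - of_real ((fwd_diff ^^ i) (\<lambda>\<gamma>. \<gamma> ^ j) x / fact j)"
    by (simp only: fps_sub_nth Suc)
  also have "\<dots> = of_real ((fwd_diff ^^ Suc i) (\<lambda>\<gamma>. \<gamma> ^ j) x / fact j)"
    by (simp add: fwd_diff_def[of "(fwd_diff ^^ i) f" for f] diff_divide_distrib)
  finally show ?case .
qed (simp add: fps_exp_def)

lemma diff_pow0_eq: "of_real (diff_pow0 i j) = fact j * fps_nth ((fps_exp 1 - 1 :: complex fps) ^ i) j"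
  using exp_diff_power_nth[of i 0 j] by (simp add: diff_pow0_def)

text \<open>Compare coefficients in the derivative of \<open>(exp t - 1)^i\<close>, which is
\<open>i ((exp t - 1)^i + (exp t - 1)^(i - 1))\<close>.\<close>

lemma diff_pow0_Suc:
  "diff_pow0 i (Suc j) = real i * (diff_pow0 i j + diff_pow0 (i - 1) j)"
proof (cases i)
  case 0
  then show ?thesis by (simp add: diff_pow0_def)
next
  case (Suc k)
  have "fps_deriv ((fps_exp 1 - 1 :: complex fps) ^ i)
      = fps_const (of_nat i) * ((fps_exp 1 - 1) ^ k * fps_exp 1)"
    using fps_deriv_power[of "fps_exp 1 - 1 :: complex fps" i] by (simp add: Suc mult_ac)
  also have "\<dots> = fps_const (of_nat i) * ((fps_exp 1 - 1) ^ i + (fps_exp 1 - 1) ^ k)"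
    by (simp add: Suc algebra_simps)
  finally have "fps_nth (fps_deriv ((fps_exp 1 - 1 :: complex fps) ^ i)) j = of_nat i *
      (fps_nth ((fps_exp 1 - 1) ^ i) j + fps_nth ((fps_exp 1 - 1) ^ k) j)" by simp
  then have "fact j * (of_nat (Suc j) * fps_nth ((fps_exp 1 - 1 :: complex fps) ^ i) (Suc j)) = fact j * (of_nat i *
      (fps_nth ((fps_exp 1 - 1) ^ i) j + fps_nth ((fps_exp 1 - 1) ^ k) j))" by simp
  then have "of_real (diff_pow0 i (Suc j)) = of_nat i * (of_real (diff_pow0 i j) + (of_real (diff_pow0 k j) :: complex))"
    by (simp only: diff_pow0_eq fact_Suc of_nat_mult) (simp add: algebra_simps)
  also have "\<dots> = of_real (real i * (diff_pow0 i j + diff_pow0 k j))" by simp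
  finally have "diff_pow0 i (Suc j) = real i * (diff_pow0 i j + diff_pow0 k j)" by (subst (asm) of_real_eq_iff)
  then show ?thesis using Suc by simp
qed

lemma exp_diff_power_nth_eq_0:
  "j < i \<Longrightarrow> fps_nth ((fps_exp 1 - 1 :: complex fps) ^ i) j = 0"
  by (rule startsby_zero_power_prefix[rule_format]) auto

lemma diff_pow0_eq_0: "j < i \<Longrightarrow> diff_pow0 i j = 0"
  using diff_pow0_eq[of i j] by (simp add: exp_diff_power_nth_eq_0)

text \<open>Expand \<open>- r / (exp t - r) = (r / (r - 1)) / (1 - u / (r - 1))\<close> as a geometric series in \<open>u = exp t - 1\<close>.
Since \<open>u ^ i\<close> starts with \<open>t ^ i\<close>, the terms up to \<open>i = j\<close> determine the coefficient of \<open>t ^ j\<close>.\<close>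

lemma apostol_fps_nth:
  assumes "r \<noteq> 1"
  shows "fact j * fps_nth (apostol_fps r) j = (\<Sum>i=0..j. r / (r - 1) ^ (i + 1) * of_real (diff_pow0 i j))"
proof -
  define u :: "complex fps" where "u = fps_exp 1 - 1"
  define g where "g i = fps_const (r / (r - 1) ^ i) * u ^ i" for i
  define S where "S = (\<Sum>i=0..j. fps_const (r / (r - 1) ^ (i + 1)) * u ^ i)"
  have "S * (u - fps_const (r - 1)) = (\<Sum>i=0..j. g (Suc i) - g i)"
    unfolding S_def sum_distrib_right
  proof (rule sum.cong[OF refl])
    fix i
    have "r / (r - 1) ^ (i + 1) * (r - 1) = r / (r - 1) ^ i" using assms by simp
    then have "fps_const (r / (r - 1) ^ (i + 1)) * fps_const (r - 1) = fps_const (r / (r - 1) ^ i)"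
      by (simp only: fps_const_mult)
    then show "fps_const (r / (r - 1) ^ (i + 1)) * u ^ i * (u - fps_const (r - 1)) = g (Suc i) - g i"
      unfolding g_def by (simp add: algebra_simps del: fps_const_mult fps_const_sub)
  qed
  also have "\<dots> = g (Suc j) - g 0"
    by (rule sum_Suc_diff) simp
  finally have "(S - g (Suc j) * inverse (fps_exp 1 - fps_const r)) * (fps_exp 1 - fps_const r)
      = g (Suc j) - g 0 - g (Suc j) * (inverse (fps_exp 1 - fps_const r) * (fps_exp 1 - fps_const r))"
    by (simp add: u_def algebra_simps fps_const_sub[symmetric] del: fps_const_sub)
  also have "inverse (fps_exp 1 - fps_const r) * (fps_exp 1 - fps_const r) = 1"
    by (rule inverse_mult_eq_1) (use assms in simp)
  finally have "S - g (Suc j) * inverse (fps_exp 1 - fps_const r) = apostol_fps r"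
    using assms by (intro apostol_fps_eqI) (simp_all add: g_def)
  moreover have "fps_nth (g (Suc j) * inverse (fps_exp 1 - fps_const r)) j = 0"
    unfolding fps_mult_nth by (rule sum.neutral) (simp add: g_def u_def exp_diff_power_nth_eq_0 del: power_Suc)
  ultimately have "fps_nth (apostol_fps r) j = fps_nth S j" by (metis diff_zero fps_sub_nth)
  then show ?thesis
    by (simp add: S_def fps_sum_nth diff_pow0_eq u_def sum_distrib_left mult_ac)
qed

lemma apostol_fps_inverse_nth:
  assumes "r \<noteq> 0" "r \<noteq> 1"
  shows "fact j * fps_nth (apostol_fps (1 / r)) j
    = (\<Sum>i=0..j. r ^ i / (1 - r) ^ (i + 1) * of_real (diff_pow0 i j))"
proof -
  have "1 / r / (1 / r - 1) ^ (i + 1) = r ^ i / (1 - r) ^ (i + 1)" for i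
  proof -
    have "1 / r - 1 = (1 - r) / r" using assms by (simp add: field_simps)
    then show ?thesis using assms by (simp add: power_divide)
  qed
  then show ?thesis using assms by (subst apostol_fps_nth) auto
qed

text \<open>In terms of generating functions, \<open>r \<partial>/\<partial>r\<close> and \<open>- \<partial>/\<partial>t\<close> agree on \<open>- r / (exp t - r)\<close>; here this is
verified on the explicit sum, where it amounts to the recurrence \<open>diff_pow0_Suc\<close>.\<close>

lemma apostol_fps_nth_deriv:
  assumes z: "z \<noteq> 1"
  shows "z * deriv (\<lambda>z. fact j * fps_nth (apostol_fps z) j) z = - (fact (Suc j) * fps_nth (apostol_fps z) (Suc j))"
proof -
  define s where "s i z = z / (z - 1) ^ (i + 1)" for i and z :: complex
  define s' where "s' i = ((z - 1) - of_nat (i + 1) * z) / (z - 1) ^ (i + 2)" for i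
  define D where "D i j = (of_real (diff_pow0 i j) :: complex)" for i j
  have s: "(s i has_field_derivative s' i) (at z)" for i
  proof -
    have "((\<lambda>z. z / (z - 1) ^ (i + 1)) has_field_derivative
        (1 * (z - 1) ^ (i + 1) - z * (of_nat (i + 1) * (z - 1) ^ i)) / ((z - 1) ^ (i + 1) * (z - 1) ^ (i + 1))) (at z)"
      by (rule derivative_eq_intros refl | use z in simp)+
    also have "(1 * (z - 1) ^ (i + 1) - z * (of_nat (i + 1) * (z - 1) ^ i)) / ((z - 1) ^ (i + 1) * (z - 1) ^ (i + 1))
       = ((z - 1) ^ i * ((z - 1) - of_nat (i + 1) * z)) / ((z - 1) ^ i * (z - 1) ^ (i + 2))"
      by (simp add: algebra_simps)
    also have "\<dots> = s' i"
      using z unfolding s'_def by (subst mult_divide_mult_cancel_left) auto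
    finally show ?thesis unfolding s_def .
  qed
  have zs': "z * s' i = - (of_nat i * s i z + of_nat (Suc i) * s (Suc i) z)" for i
  proof -
    have "of_nat i * s i z + of_nat (Suc i) * s (Suc i) z
        = (of_nat i * z * (z - 1) + of_nat (Suc i) * z) / (z - 1) ^ (i + 2)"
      using z by (simp add: s_def add_divide_distrib)
    moreover have "z * s' i = - ((of_nat i * z * (z - 1) + of_nat (Suc i) * z) / (z - 1) ^ (i + 2))"
      unfolding s'_def minus_divide_left times_divide_eq_right
      by (rule arg_cong2[of _ _ _ _ "(/)"]) (simp_all add: algebra_simps)
    ultimately show ?thesis by simp
  qed
  have ev: "\<forall>\<^sub>F w in nhds z. fact j * fps_nth (apostol_fps w) j = (\<Sum>i=0..j. s i w * D i j)"
    using apostol_fps_nth by (intro eventually_mono[OF t1_space_nhds[OF z]]) (auto simp: s_def D_def)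
  have "((\<lambda>w. \<Sum>i=0..j. s i w * D i j) has_field_derivative (\<Sum>i=0..j. s' i * D i j)) (at z)"
    by (intro DERIV_sum DERIV_cmult_right s)
  then have "deriv (\<lambda>z. fact j * fps_nth (apostol_fps z) j) z = (\<Sum>i=0..j. s' i * D i j)"
    by (simp only: deriv_cong_ev[OF ev refl] DERIV_imp_deriv)
  then have "z * deriv (\<lambda>z. fact j * fps_nth (apostol_fps z) j) z = (\<Sum>i=0..j. (z * s' i) * D i j)"
    by (simp add: sum_distrib_left mult.assoc)
  also have "\<dots> = - ((\<Sum>i=0..j. of_nat i * s i z * D i j) + (\<Sum>i=0..j. of_nat (Suc i) * s (Suc i) z * D i j))"
    unfolding zs' by (simp add: algebra_simps sum.distrib sum_negf sum_subtractf)
  also have "(\<Sum>i=0..j. of_nat i * s i z * D i j) = (\<Sum>i=0..Suc j. of_nat i * s i z * D i j)"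
    by (simp add: D_def diff_pow0_eq_0)
  also have "(\<Sum>i=0..j. of_nat (Suc i) * s (Suc i) z * D i j)
      = (\<Sum>i=Suc 0..Suc j. of_nat i * s i z * D (i - 1) j)"
    by (subst sum.shift_bounds_cl_Suc_ivl) simp
  also have "\<dots> = (\<Sum>i=0..Suc j. of_nat i * s i z * D (i - 1) j)"
    by (subst (2) sum.atLeast_Suc_atMost) auto
  also have "(\<Sum>i=0..Suc j. of_nat i * s i z * D i j) + (\<Sum>i=0..Suc j. of_nat i * s i z * D (i - 1) j)
      = (\<Sum>i=0..Suc j. s i z * D i (Suc j))"
    unfolding sum.distrib[symmetric] by (intro sum.cong refl) (simp add: D_def diff_pow0_Suc algebra_simps)
  also have "\<dots> = fact (Suc j) * fps_nth (apostol_fps z) (Suc j)"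
    by (subst apostol_fps_nth[OF z]) (simp add: s_def D_def)
  finally show ?thesis .
qed

section \<open>Roots of the Euler polynomials\<close>

lemma euler_operator_eq_apostol_fps:
  assumes "z \<noteq> 1"
  shows "((\<lambda>f z. z * deriv f z) ^^ k) (\<lambda>z. z / (1 - z)\<^sup>2) z
    = (-1) ^ k * (fact (k + 1) * fps_nth (apostol_fps z) (k + 1))"
  using assms
proof (induction k arbitrary: z)
  case 0
  have "diff_pow0 0 1 = 0" "diff_pow0 1 1 = 1" by (simp_all add: diff_pow0_def fwd_diff_def)
  moreover have "(1 - z)\<^sup>2 = (z - 1)\<^sup>2" by (simp add: power2_commute)
  ultimately show ?case using apostol_fps_nth[of z 1] 0 by (simp add: power2_eq_square)
next
  case (Suc k)
  let ?F = "((\<lambda>f z. z * deriv f z) ^^ k) (\<lambda>z::complex. z / (1 - z)\<^sup>2)"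
  have "\<forall>\<^sub>F w in nhds z. ?F w = (-1) ^ k * (fact (k + 1) * fps_nth (apostol_fps w) (k + 1))"
    using Suc.IH by (intro eventually_mono[OF t1_space_nhds[OF Suc.prems]]) auto
  then have "z * deriv ?F z = z * deriv (\<lambda>w. (-1) ^ k * (fact (k + 1) * fps_nth (apostol_fps w) (k + 1))) z"
    by (simp add: deriv_cong_ev)
  also have "\<dots> = (-1) ^ k * (z * deriv (\<lambda>w. fact (k + 1) * fps_nth (apostol_fps w) (k + 1)) z)"
  proof -
    have "(\<lambda>w. fact (k + 1) * fps_nth (apostol_fps w) (k + 1)) field_differentiable (at z)"
    proof -
      have "\<forall>\<^sub>F w in nhds z. (\<Sum>i=0..k+1. w / (w - 1) ^ (i + 1) * of_real (diff_pow0 i (k+1))) = fact (k+1) * fps_nth (apostol_fps w) (k+1)"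
        by (intro eventually_mono[OF t1_space_nhds[OF Suc.prems]] apostol_fps_nth[symmetric]) auto
      moreover obtain D where "((\<lambda>w. \<Sum>i=0..k+1. w / (w - 1) ^ (i + 1) * of_real (diff_pow0 i (k+1))) has_field_derivative D) (at z)"
      proof -
        have "(\<lambda>w. \<Sum>i=0..k+1. w / (w - 1) ^ (i + 1) * of_real (diff_pow0 i (k+1))) field_differentiable (at z)"
          using Suc.prems by (intro derivative_intros) auto
        then show ?thesis using that unfolding field_differentiable_def by blast
      qed
      ultimately show ?thesis
        unfolding field_differentiable_def 
        using DERIV_cong_ev[where x = z and y = z, OF refl _ refl] by fast
    qed
    then show ?thesis by (simp add: deriv_cmult)
  qed
  also have "\<dots> = (-1) ^ k * - (fact (Suc (k + 1)) * fps_nth (apostol_fps z) (Suc (k + 1)))"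
    unfolding apostol_fps_nth_deriv[OF Suc.prems] ..
  finally show ?case by (simp del: fact_Suc)
qed

text \<open>Needed only to exclude 0 as a root. The defining formula of the polynomial is singular there, so the
polynomial is first written as a sum without negative powers; at 0 this becomes the alternating sum of
\<open>\<Delta>^i 0^(k+1)\<close>, a coefficient of \<open>1 / (1 + u) = exp (- t)\<close> with \<open>u = exp t - 1\<close>.\<close>

lemma euler_poly_0: "poly (euler_poly k) 0 = 1"
proof -
  define P :: "complex poly" where "P = (\<Sum>i=0..k+1. smult ((-1) ^ (i + 1 + k) * of_real (diff_pow0 i (k + 1))) ([:1, -1:] ^ (k + 1 - i)))"
  have "poly (euler_poly k) x = poly P x" if x: "x \<noteq> 0" "x \<noteq> 1" for x
  proof -
    have "poly (euler_poly k) x = (\<Sum>i=0..k+1. (1 - x) ^ (k + 2) / x * ((-1) ^ k * (x / (x - 1) ^ (i + 1) * of_real (diff_pow0 i (k + 1)))))"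
      unfolding poly_euler_poly[OF x] euler_operator_eq_apostol_fps[OF x(2)] apostol_fps_nth[OF x(2)] sum_distrib_left ..
    also have "\<dots> = poly P x"
      unfolding P_def poly_sum
    proof (rule sum.cong[OF refl])
      fix i assume i: "i \<in> {0..k+1}"
      have "(x - 1) ^ (i + 1) = (-1) ^ (i + 1) * (1 - x) ^ (i + 1)"
        using power_minus[of "1 - x" "i + 1"] by (simp del: power_Suc)
      moreover have "(1 - x) ^ (k + 2) = (1 - x) ^ (k + 1 - i) * (1 - x) ^ (i + 1)"
        using i by (simp flip: power_add)
      moreover define a e D where "a = (1 - x) ^ (i + 1)" and "e = (- 1 :: complex) ^ (i + 1)"
        and "D = (of_real (diff_pow0 i (k + 1)) :: complex)"
      moreover have "e * e = 1" by (simp add: e_def flip: power_mult_distrib)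
      moreover have "a \<noteq> 0" "e \<noteq> 0" using x by (simp_all add: a_def e_def)
      ultimately have "(1 - x) ^ (k + 2) / x * ((-1) ^ k * (x / (x - 1) ^ (i + 1) * D))
          = e * (-1) ^ k * D * (1 - x) ^ (k + 1 - i)"
        using x by (simp del: power_Suc add: divide_simps)
      then show "(1 - x) ^ (k + 2) / x * ((-1) ^ k * (x / (x - 1) ^ (i + 1) * of_real (diff_pow0 i (k + 1))))
         = poly (smult ((-1) ^ (i + 1 + k) * of_real (diff_pow0 i (k + 1))) ([:1, -1:] ^ (k + 1 - i))) x"
        by (simp add: poly_power power_add D_def e_def mult_ac)
    qed
    finally show ?thesis .
  qed
  then have "- {0, 1} \<subseteq> {x. poly (euler_poly k - P) x = 0}" by auto
  moreover have "infinite (- {0, 1 :: complex})"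
    by (simp add: infinite_UNIV_char_0 Compl_eq_Diff_UNIV)
  ultimately have "infinite {x. poly (euler_poly k - P) x = 0}"
    using finite_subset by blast
  then have "euler_poly k - P = 0" using poly_roots_finite by blast
  then have "poly (euler_poly k) 0 = (\<Sum>i=0..k+1. (-1) ^ (i + 1 + k) * of_real (diff_pow0 i (k + 1)))"
    by (simp add: P_def poly_sum poly_power)
  also have "\<dots> = (-1) ^ (k + 1) * (\<Sum>i=0..k+1. (-1) ^ i * fact (k + 1) * fps_nth ((fps_exp 1 - 1) ^ i) (k + 1))"
    unfolding diff_pow0_eq sum_distrib_left by (intro sum.cong refl) (simp add: power_add)
  also have "(\<Sum>i=0..k+1. (-1) ^ i * fact (k + 1) * fps_nth ((fps_exp 1 - 1 :: complex fps) ^ i) (k + 1))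
      = fact (k + 1) * fps_nth (\<Sum>i=0..k+1. (1 - fps_exp 1) ^ i) (k + 1)"
  proof -
    have "fps_nth ((1 - fps_exp 1 :: complex fps) ^ i) n = (-1) ^ i * fps_nth ((fps_exp 1 - 1) ^ i) n" for i n
    proof -
      have "(1 - fps_exp 1 :: complex fps) ^ i = fps_const ((-1) ^ i) * (fps_exp 1 - 1) ^ i"
        using power_minus[of "fps_exp 1 - 1 :: complex fps" i]
        by (simp flip: fps_const_power fps_const_neg)
      then show ?thesis by simp
    qed
    then show ?thesis
      by (simp add: fps_sum_nth sum_distrib_left mult_ac del: power_Suc fact_Suc sum.cl_ivl_Suc)
  qed
  also have "fps_nth (\<Sum>i=0..k+1. (1 - fps_exp 1 :: complex fps) ^ i) (k + 1) = fps_nth (fps_exp (- 1)) (k + 1)"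
  proof -
    have "(\<Sum>i=0..k+1. (1 - fps_exp 1 :: complex fps) ^ i) * fps_exp 1 = 1 - (1 - fps_exp 1) ^ Suc (k + 1)"
      using sum_gp_basic[of "1 - fps_exp 1 :: complex fps" "k + 1"] by (simp add: mult.commute atMost_atLeast0)
    then have "(\<Sum>i=0..k+1. (1 - fps_exp 1 :: complex fps) ^ i) * (fps_exp 1 * fps_exp (- 1))
        = (1 - (1 - fps_exp 1) ^ Suc (k + 1)) * fps_exp (- 1)" by (simp only: mult.assoc[symmetric])
    then have "(\<Sum>i=0..k+1. (1 - fps_exp 1 :: complex fps) ^ i)
        = fps_exp (- 1) - (1 - fps_exp 1) ^ Suc (k + 1) * fps_exp (- 1)"
      by (simp add: left_diff_distrib flip: fps_exp_add_mult)
    moreover have "fps_nth ((1 - fps_exp 1 :: complex fps) ^ Suc (k + 1) * fps_exp (- 1)) (k + 1) = 0"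
      unfolding fps_mult_nth by (rule sum.neutral) (simp add: startsby_zero_power_prefix[rule_format] del: power_Suc power_Suc2)
    ultimately show ?thesis by simp
  qed
  finally have "poly (euler_poly k) 0 = (-1) ^ (k + 1) * (-1) ^ (k + 1)"
    by (simp del: power_Suc fact_Suc)
  also have "\<dots> = 1" by (simp flip: power_mult_distrib)
  finally show ?thesis .
qed

text \<open>So the exponential spline of a root has the value 0 at one node and therefore at all nodes.\<close>

lemma euler_poly_root:
  assumes "poly (euler_poly k) z = 0" "z \<noteq> 1"
  shows "z \<noteq> 0" "fps_nth (apostol_fps z) (k + 1) = 0"
proof -
  show "z \<noteq> 0" using assms(1) euler_poly_0[of k] by auto
  then show "fps_nth (apostol_fps z) (k + 1) = 0"
    using assms by (simp add: poly_euler_poly euler_operator_eq_apostol_fps del: fact_Suc power_Suc)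
qed

section \<open>Values of the extremal spline at the nodes\<close>

text \<open>Passage from the complex generating functions in units of the mesh width to real splines on \<open>[0,1]\<close>.
The linear map \<open>L\<close> is there to take real or imaginary parts, with a sign: the \<open>q k\<close>, \<open>d k\<close>, \<open>p k\<close> are complex
numbers, and no symmetry under conjugation is imposed on them. At a node only the jumps at nodes
\<open>\<beta> \<le> b\<close> contribute, and the one at \<open>\<beta> = b\<close> vanishes as \<open>n \<ge> 2\<close>; this is why the sum may run up to \<open>b\<close> even
if \<open>b = N\<close> is not an inner node.\<close>

lemma spline_at_knot:
  fixes L :: "complex \<Rightarrow> real"
  assumes L: "linear L" and n: "n \<ge> 2" and b: "b \<le> N" and N: "N \<ge> 1" and h: "h = 1 / real N"
  shows "spline (Abs_fps (\<lambda>j. L (fps_nth Z j) * h ^ j)) (\<lambda>\<beta>. h * L (c \<beta>)) N n (real b / real N)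
    = h ^ n * L (fps_nth (Z * fps_exp (of_nat b)
        - fps_X * (\<Sum>\<beta>=1..b. fps_const (c \<beta>) * fps_exp (of_nat (b - \<beta>)))) n)"
proof -
  have L_real: "L (z * of_real r) = L z * r" for z r
    using linear_scale[OF L, of r z] by (simp add: scaleR_conv_of_real mult.commute)
  define f where "f \<beta> = L (c \<beta>) * (real (b - \<beta>) ^ (n - 1) / fact (n - 1))" for \<beta>
  have bN: "real \<beta> / real N = h * real \<beta>" for \<beta> by (simp add: h)
  have hpos: "h > 0" using N h by simp
  have "fps_nth (Abs_fps (\<lambda>j. L (fps_nth Z j) * h ^ j) * fps_exp (h * real b)) n
      = (\<Sum>i=0..n. h ^ n * (L (fps_nth Z i) * (real b ^ (n - i) / fact (n - i))))"
    unfolding fps_mult_nth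
  proof (rule sum.cong[OF refl])
    fix i assume "i \<in> {0..n}"
    then have "h ^ n = h ^ i * h ^ (n - i)" by (simp flip: power_add)
    then show "fps_nth (Abs_fps (\<lambda>j. L (fps_nth Z j) * h ^ j)) i * fps_nth (fps_exp (h * real b)) (n - i)
        = h ^ n * (L (fps_nth Z i) * (real b ^ (n - i) / fact (n - i)))"
      by (simp add: power_mult_distrib)
  qed
  also have "\<dots> = h ^ n * (\<Sum>i=0..n. L (fps_nth Z i * of_real (real b ^ (n - i) / fact (n - i))))"
    by (simp only: sum_distrib_left L_real)
  also have "\<dots> = h ^ n * L (fps_nth (Z * fps_exp (of_nat b)) n)"
    by (simp add: fps_mult_nth linear_sum[OF L])
  finally have poly: "fps_nth (Abs_fps (\<lambda>j. L (fps_nth Z j) * h ^ j) * fps_exp (h * real b)) n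
      = h ^ n * L (fps_nth (Z * fps_exp (of_nat b)) n)" .
  have "(\<Sum>\<beta>\<in>{1..<N}. h * L (c \<beta>) * trunc_power (n - 1) (h * real \<beta>) (h * real b))
      = (\<Sum>\<beta>\<in>{1..<N}. if \<beta> \<le> b then h ^ n * f \<beta> else 0)"
  proof (rule sum.cong[OF refl])
    fix \<beta>
    have "h ^ n = h * h ^ (n - 1)" using n by (cases n) auto
    then show "h * L (c \<beta>) * trunc_power (n - 1) (h * real \<beta>) (h * real b) = (if \<beta> \<le> b then h ^ n * f \<beta> else 0)"
      using hpos by (simp add: trunc_power_def f_def of_nat_diff power_mult_distrib flip: right_diff_distrib)
  qed
  also have "\<dots> = (\<Sum>\<beta>=1..b. h ^ n * f \<beta>)"
  proof (rule sum.mono_neutral_cong)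
    fix \<beta> assume "\<beta> \<in> {1..b} - {1..<N}"
    then have "\<beta> = b" using b by auto
    then show "h ^ n * f \<beta> = 0" using n by (simp add: f_def)
  qed auto
  also have "\<dots> = h ^ n * (\<Sum>\<beta>=1..b. L (c \<beta> * of_real (real (b - \<beta>) ^ (n - 1) / fact (n - 1))))"
    by (simp only: f_def sum_distrib_left L_real)
  also have "\<dots> = h ^ n * L (fps_nth (fps_X * (\<Sum>\<beta>=1..b. fps_const (c \<beta>) * fps_exp (of_nat (b - \<beta>)))) n)"
    using n by (simp add: fps_sum_nth linear_sum[OF L])
  finally show ?thesis
    unfolding spline_def bN poly by (simp add: linear_diff[OF L] right_diff_distrib)
qed

text \<open>The combination of exponential splines that the linear system selects, expanded at node \<open>b\<close>. Up to
the factor \<open>q k ^ N\<close>, the terms with \<open>p k\<close> are those of the parameter \<open>1 / q k\<close>.\<close>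

definition euler_part :: "nat \<Rightarrow> nat \<Rightarrow> (nat \<Rightarrow> complex) \<Rightarrow> (nat \<Rightarrow> complex) \<Rightarrow> (nat \<Rightarrow> complex) \<Rightarrow> nat \<Rightarrow> complex fps" where
  "euler_part r N q d p b = (\<Sum>k=1..r. fps_const (d k * q k ^ b) * apostol_fps (q k)
      + fps_const (p k * q k ^ (N - b)) * apostol_fps (1 / q k))"

text \<open>Apart from the factor \<open>h\<close>, these are the coefficients of the optimal formula at the inner nodes if
\<open>d\<close> and \<open>p\<close> solve the linear system.\<close>

definition node_coeff :: "nat \<Rightarrow> nat \<Rightarrow> (nat \<Rightarrow> complex) \<Rightarrow> (nat \<Rightarrow> complex) \<Rightarrow> (nat \<Rightarrow> complex) \<Rightarrow> nat \<Rightarrow> complex" where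
  "node_coeff r N q d p \<beta> = 1 + (\<Sum>k=1..r. d k * q k ^ \<beta> + p k * q k ^ (N - \<beta>))"

lemma euler_part_shift:
  assumes q: "\<And>k. k \<in> {1..r} \<Longrightarrow> q k \<noteq> 0 \<and> q k \<noteq> 1" and b: "b \<le> N"
  shows "euler_part r N q d p 0 * fps_exp (of_nat b) = euler_part r N q d p b
    - (\<Sum>\<beta>=1..b. fps_const (node_coeff r N q d p \<beta> - 1) * fps_exp (of_nat (b - \<beta>)))"
proof -
  define e where "e \<beta> = (fps_exp (of_nat (b - \<beta>)) :: complex fps)" for \<beta>
  have "(fps_const (d k * q k ^ 0) * apostol_fps (q k) + fps_const (p k * q k ^ (N - 0)) * apostol_fps (1 / q k)) * fps_exp (of_nat b)
      = fps_const (d k * q k ^ b) * apostol_fps (q k) + fps_const (p k * q k ^ (N - b)) * apostol_fps (1 / q k)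
        - (\<Sum>\<beta>=1..b. fps_const (d k * q k ^ \<beta> + p k * q k ^ (N - \<beta>)) * e \<beta>)" if k: "k \<in> {1..r}" for k
  proof -
    have qk: "q k \<noteq> 0" "q k \<noteq> 1" "1 / q k \<noteq> 1" using q[OF k] by auto
    have pw: "q k ^ N * (1 / q k) ^ j = q k ^ (N - j)" if "j \<le> b" for j
      using that b qk(1) by (simp add: power_diff power_divide)
    have "(fps_const (d k * q k ^ 0) * apostol_fps (q k) + fps_const (p k * q k ^ (N - 0)) * apostol_fps (1 / q k)) * fps_exp (of_nat b)
      = fps_const (d k) * (apostol_fps (q k) * fps_exp (of_nat b)) + fps_const (p k * q k ^ N) * (apostol_fps (1 / q k) * fps_exp (of_nat b))"
      by (simp add: algebra_simps)
    also have "\<dots> = fps_const (d k * q k ^ b) * apostol_fps (q k) + fps_const (p k * (q k ^ N * (1 / q k) ^ b)) * apostol_fps (1 / q k)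
       - ((\<Sum>\<beta>=1..b. fps_const (d k * q k ^ \<beta>) * e \<beta>)
         + (\<Sum>\<beta>=1..b. fps_const (p k * (q k ^ N * (1 / q k) ^ \<beta>)) * e \<beta>))"
      unfolding apostol_fps_shift[OF qk(2)] apostol_fps_shift[OF qk(3)] e_def[symmetric]
      by (simp only: right_diff_distrib sum_distrib_left mult.assoc[symmetric] fps_const_mult) simp
    also have "(\<Sum>\<beta>=1..b. fps_const (p k * (q k ^ N * (1 / q k) ^ \<beta>)) * e \<beta>)
        = (\<Sum>\<beta>=1..b. fps_const (p k * q k ^ (N - \<beta>)) * e \<beta>)"
      by (intro sum.cong refl) (simp only: pw atLeastAtMost_iff)
    also have "q k ^ N * (1 / q k) ^ b = q k ^ (N - b)" by (rule pw) simp
    finally show ?thesis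
      by (simp only: sum.distrib[symmetric] distrib_right[symmetric] fps_const_add)
  qed
  then have "euler_part r N q d p 0 * fps_exp (of_nat b) = euler_part r N q d p b
      - (\<Sum>k=1..r. \<Sum>\<beta>=1..b. fps_const (d k * q k ^ \<beta> + p k * q k ^ (N - \<beta>)) * e \<beta>)"
    unfolding euler_part_def sum_distrib_right sum_subtractf[symmetric] by (intro sum.cong refl) auto
  also have "(\<Sum>k=1..r. \<Sum>\<beta>=1..b. fps_const (d k * q k ^ \<beta> + p k * q k ^ (N - \<beta>)) * e \<beta>)
      = (\<Sum>\<beta>=1..b. fps_const (node_coeff r N q d p \<beta> - 1) * e \<beta>)"
  proof (subst sum.swap, rule sum.cong[OF refl])
    fix \<beta>
    show "(\<Sum>k=1..r. fps_const (d k * q k ^ \<beta> + p k * q k ^ (N - \<beta>)) * e \<beta>)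
        = fps_const (node_coeff r N q d p \<beta> - 1) * e \<beta>"
      by (simp add: node_coeff_def fps_ext fps_sum_nth flip: sum_distrib_right)
  qed
  finally show ?thesis by (simp add: e_def)
qed

text \<open>The Bernoulli part provides the leading coefficient of the extremal function and the exponential
splines adjust its boundary values; the last term removes the common value \<open>B\<^bsub>2m\<^esub> / (2m)!\<close> of the Bernoulli
part at the nodes.\<close>

definition extremal_fps :: "nat \<Rightarrow> nat \<Rightarrow> (nat \<Rightarrow> complex) \<Rightarrow> (nat \<Rightarrow> complex) \<Rightarrow> (nat \<Rightarrow> complex) \<Rightarrow> complex fps" where
  "extremal_fps m N q d p = bernoulli_fps - fps_X * euler_part (m - 1) N q d p 0
     - fps_const (fps_nth bernoulli_fps (2 * m)) * fps_X ^ (2 * m)"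

lemma extremal_at_knot:
  assumes q: "\<And>k. k \<in> {1..m - 1} \<Longrightarrow> q k \<noteq> 0 \<and> q k \<noteq> 1" and b: "b \<le> N" and n: "n \<ge> 1"
  shows "fps_nth (extremal_fps m N q d p * fps_exp (of_nat b)
      - fps_X * (\<Sum>\<beta>=1..b. fps_const (node_coeff (m - 1) N q d p \<beta>) * fps_exp (of_nat (b - \<beta>)))) n
    = fps_nth bernoulli_fps n - fps_nth (euler_part (m - 1) N q d p b) (n - 1)
      - (if n < 2 * m then 0 else fps_nth bernoulli_fps (2 * m) * of_nat b ^ (n - 2 * m) / fact (n - 2 * m))"
proof -
  define S where "S c = (\<Sum>\<beta>=1..b. fps_const (c \<beta>) * (fps_exp (of_nat (b - \<beta>)) :: complex fps))" for c
  have S: "S (\<lambda>\<beta>. node_coeff (m - 1) N q d p \<beta>) = S (\<lambda>_. 1) + S (\<lambda>\<beta>. node_coeff (m - 1) N q d p \<beta> - 1)"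
    unfolding S_def sum.distrib[symmetric] by (simp only: distrib_right[symmetric] fps_const_add) simp
  have shift: "euler_part (m - 1) N q d p 0 * fps_exp (of_nat b)
      = euler_part (m - 1) N q d p b - S (\<lambda>\<beta>. node_coeff (m - 1) N q d p \<beta> - 1)"
    unfolding S_def by (rule euler_part_shift[OF q b])
  have "extremal_fps m N q d p * fps_exp (of_nat b)
      = bernoulli_fps * fps_exp (of_nat b) - fps_X * (euler_part (m - 1) N q d p 0 * fps_exp (of_nat b))
        - fps_const (fps_nth bernoulli_fps (2 * m)) * (fps_X ^ (2 * m) * fps_exp (of_nat b))"
    unfolding extremal_fps_def by (simp only: left_diff_distrib mult.assoc)
  also have "\<dots> = bernoulli_fps + fps_X * S (\<lambda>_. 1) - fps_X * (euler_part (m - 1) N q d p b - S (\<lambda>\<beta>. node_coeff (m - 1) N q d p \<beta> - 1))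
        - fps_const (fps_nth bernoulli_fps (2 * m)) * (fps_X ^ (2 * m) * fps_exp (of_nat b))"
    using bernoulli_fps_shift[of b] shift by (simp add: S_def)
  finally have "extremal_fps m N q d p * fps_exp (of_nat b) - fps_X * S (\<lambda>\<beta>. node_coeff (m - 1) N q d p \<beta>)
     = bernoulli_fps - fps_X * euler_part (m - 1) N q d p b
        - fps_const (fps_nth bernoulli_fps (2 * m)) * (fps_X ^ (2 * m) * fps_exp (of_nat b))"
    unfolding S by (simp add: algebra_simps)
  then show ?thesis unfolding S_def[symmetric]
    using n by (simp add: fps_X_power_mult_nth)
qed

lemma fps_nth_euler_part:
  "fps_nth (euler_part r N q d p b) j
    = (\<Sum>k=1..r. d k * q k ^ b * fps_nth (apostol_fps (q k)) j + p k * q k ^ (N - b) * fps_nth (apostol_fps (1 / q k)) j)"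
  by (simp add: euler_part_def fps_sum_nth)

section \<open>The norm of the optimal error functional\<close>

lemma minus_one_power_divide:
  fixes x y a :: complex
  shows "a * (-1) ^ n / (x - y) ^ n = a / (y - x) ^ n"
proof -
  have "(y - x) ^ n = (-1) ^ n * (x - y) ^ n"
    using power_minus[of "x - y" n] by simp
  then show ?thesis by (cases "even n") auto
qed

text \<open>The left-hand sides of the linear system are, up to factorials, boundary values of the exponential
splines: this sum belongs to the left end, the next one to the right end, and the two after it to
their difference.\<close>

lemma left_end_sum:
  assumes "r \<noteq> 0" "r \<noteq> 1"
  shows "(\<Sum>i=0..j. (d * r + p * r ^ (N + i) * (-1) ^ (i + 1)) / (r - 1) ^ (i + 1) * of_real (diff_pow0 i j))
    = fact j * (d * fps_nth (apostol_fps r) j + p * r ^ N * fps_nth (apostol_fps (1 / r)) j)"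
proof -
  have "(\<Sum>i=0..j. (d * r + p * r ^ (N + i) * (-1) ^ (i + 1)) / (r - 1) ^ (i + 1) * of_real (diff_pow0 i j))
    = (\<Sum>i=0..j. d * (r / (r - 1) ^ (i + 1) * of_real (diff_pow0 i j))
        + p * r ^ N * (r ^ i / (1 - r) ^ (i + 1) * of_real (diff_pow0 i j)))"
    unfolding add_divide_distrib minus_one_power_divide
    by (intro sum.cong refl) (simp only: power_add[of r] distrib_left distrib_right times_divide_eq_right times_divide_eq_left mult_ac)
  also have "\<dots> = d * (\<Sum>i=0..j. r / (r - 1) ^ (i + 1) * of_real (diff_pow0 i j))
      + p * r ^ N * (\<Sum>i=0..j. r ^ i / (1 - r) ^ (i + 1) * of_real (diff_pow0 i j))"
    unfolding sum.distrib sum_distrib_left ..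
  also have "\<dots> = fact j * (d * fps_nth (apostol_fps r) j + p * r ^ N * fps_nth (apostol_fps (1 / r)) j)"
    unfolding apostol_fps_nth[OF assms(2), symmetric] apostol_fps_inverse_nth[OF assms, symmetric]
    by (simp add: algebra_simps)
  finally show ?thesis .
qed

lemma right_end_sum:
  assumes "r \<noteq> 0" "r \<noteq> 1"
  shows "(\<Sum>i=0..j. ((-1) ^ (i + 1) * d * r ^ (N + i) + p * r) / (r - 1) ^ (i + 1) * of_real (diff_pow0 i j))
    = fact j * (d * r ^ N * fps_nth (apostol_fps (1 / r)) j + p * fps_nth (apostol_fps r) j)"
  using left_end_sum[OF assms, of p d N j] by (simp add: algebra_simps)

lemma end_difference_sum:
  assumes "r \<noteq> 0" "r \<noteq> 1"
  shows "(\<Sum>i=0..j. c * (((-1) ^ (i + 1) * d * r ^ i - p * r) / (r - 1) ^ (i + 1)) * of_real (diff_pow0 i j))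
    = fact j * (c * (d * fps_nth (apostol_fps (1 / r)) j - p * fps_nth (apostol_fps r) j))"
proof -
  have "(\<Sum>i=0..j. c * (((-1) ^ (i + 1) * d * r ^ i - p * r) / (r - 1) ^ (i + 1)) * of_real (diff_pow0 i j))
      = c * (\<Sum>i=0..j. ((-1) ^ (i + 1) * d * r ^ (0 + i) + (- p) * r) / (r - 1) ^ (i + 1) * of_real (diff_pow0 i j))"
    by (simp add: sum_distrib_left mult.assoc)
  then show ?thesis unfolding right_end_sum[OF assms] by (simp add: algebra_simps)
qed

lemma end_difference_sum_alt:
  assumes "r \<noteq> 0" "r \<noteq> 1"
  shows "(\<Sum>i=0..j. c * (d * r ^ i + (-1) ^ i * p * r) / (1 - r) ^ (i + 1) * of_real (diff_pow0 i j))
    = fact j * (c * (d * fps_nth (apostol_fps (1 / r)) j - p * fps_nth (apostol_fps r) j))"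
proof -
  have "(d * r ^ i + (-1) ^ i * p * r) / (1 - r) ^ (i + 1) = ((-1) ^ (i + 1) * d * r ^ i - p * r) / (r - 1) ^ (i + 1)" for i
  proof -
    have "((-1) ^ (i + 1) * d * r ^ i - p * r) = (d * r ^ i + (-1) ^ i * p * r) * (-1) ^ (i + 1)"
      by (cases "even i") (simp_all add: algebra_simps)
    then show ?thesis using minus_one_power_divide[of _ "i + 1" r 1] by simp
  qed
  then show ?thesis
    unfolding end_difference_sum[OF assms, symmetric] times_divide_eq_right[symmetric] by simp
qed

theorem theorem5p2:
  fixes m N :: nat and h :: real
    and C :: "nat \<Rightarrow> real" and A B :: real
    and q d p :: "nat \<Rightarrow> complex"
  assumes "m \<ge> 2" and "N \<ge> 1" and "h = 1 / real N"
    and optimal: "optimal_quadrature m N C A B"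
    and roots: "bij_betw q {1..m - 1} {z. poly (euler_poly (2 * m - 2)) z = 0 \<and> norm z < 1}"
    and sys1: "\<And>j. j \<in> {2..m - 1} \<Longrightarrow>
      (\<Sum>k=1..m - 1. \<Sum>i=0..j.
         (d k * q k + p k * q k ^ (N + i) * (-1) ^ (i + 1)) / (q k - 1) ^ (i + 1)
           * of_real (diff_pow0 i j)) = of_real (bernoulli_num (j + 1) / real (j + 1))"
    and sys2: "(\<Sum>k=1..m - 1. \<Sum>i=0..2 * m - 2.
         (d k * q k + p k * q k ^ (N + i) * (-1) ^ (i + 1)) / (q k - 1) ^ (i + 1)
           * of_real (diff_pow0 i (2 * m - 2))) = 0"
    and sys3: "\<And>j. j \<in> {2..m - 1} \<Longrightarrow>
      (\<Sum>k=1..m - 1. \<Sum>i=0..j.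
         (1 - q k ^ N) * (((-1) ^ (i + 1) * d k * q k ^ i - p k * q k) / (q k - 1) ^ (i + 1))
           * of_real (diff_pow0 i j)) = 0"
    and sys4: "(\<Sum>k=1..m - 1. \<Sum>i=0..2 * m - 2.
         ((-1) ^ (i + 1) * d k * q k ^ (N + i) + p k * q k) / (q k - 1) ^ (i + 1)
           * of_real (diff_pow0 i (2 * m - 2))) = 0"
  shows "of_real ((real_of_ereal (error_norm m N C A B))\<^sup>2) =
    (-1) ^ (m + 1) *
      (of_real (bernoulli_num (2 * m) * h ^ (2 * m) / fact (2 * m))
       + of_real (h ^ (2 * m + 1) / fact (2 * m)) *
         (\<Sum>k=1..m - 1. \<Sum>i=0..2 * m.
            (1 - q k ^ N) * (d k * q k ^ i + (-1) ^ i * p k * q k) / (1 - q k) ^ (i + 1)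
              * of_real (diff_pow0 i (2 * m))))"
proof -
  have m: "m \<ge> 2" and N: "N \<ge> 1" and h: "h = 1 / real N" by fact+
  define a where "a j k = fps_nth (apostol_fps (q k)) j" for j k
  define a' where "a' j k = fps_nth (apostol_fps (1 / q k)) j" for j k
  have q: "q k \<noteq> 0 \<and> q k \<noteq> 1" and root: "a (2 * m - 1) k = 0" if "k \<in> {1..m - 1}" for k
  proof -
    have "poly (euler_poly (2 * m - 2)) (q k) = 0" "norm (q k) < 1"
      using bij_betw_apply[OF roots that] by auto
    moreover from this have "q k \<noteq> 1" by auto
    moreover have "2 * m - 2 + 1 = 2 * m - 1" using m by simp
    ultimately show "q k \<noteq> 0 \<and> q k \<noteq> 1" "a (2 * m - 1) k = 0"
      using euler_poly_root[of "2 * m - 2" "q k"] by (auto simp: a_def)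
  qed
  have reflect: "a' j k = (-1) ^ (j + 1) * a j k" if "k \<in> {1..m - 1}" "j \<ge> 1" for j k
    unfolding a_def a'_def using q[OF that(1)] that(2) by (intro apostol_fps_reflect) auto

  have eq1: "(\<Sum>k=1..m - 1. d k * a j k + p k * q k ^ N * a' j k) = fps_nth bernoulli_fps (j + 1)"
    if j: "j \<in> {2..m - 1}" for j
  proof -
    have "fact j * (\<Sum>k=1..m - 1. d k * a j k + p k * q k ^ N * a' j k)
        = of_real (bernoulli_num (j + 1) / real (j + 1))"
      unfolding sys1[OF j, symmetric] sum_distrib_left a_def a'_def
      by (intro sum.cong refl left_end_sum[symmetric]) (use q in auto)
    moreover have "of_real (bernoulli_num (j + 1) / real (j + 1)) = fact j * fps_nth bernoulli_fps (j + 1)"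
      using of_nat_neq_0[of j, where ?'a = complex] by (simp add: bernoulli_fps_def divide_simps)
    ultimately show ?thesis by simp
  qed
  have eq3: "(\<Sum>k=1..m - 1. (1 - q k ^ N) * (d k * a' j k - p k * a j k)) = 0"
    if j: "j \<in> {2..m - 1}" for j
  proof -
    have "fact j * (\<Sum>k=1..m - 1. (1 - q k ^ N) * (d k * a' j k - p k * a j k)) = 0"
      unfolding sys3[OF j, symmetric] sum_distrib_left a_def a'_def
      by (intro sum.cong refl end_difference_sum[symmetric]) (use q in auto)
    then show ?thesis by simp
  qed
  have eq2: "(\<Sum>k=1..m - 1. d k * a (2 * m - 2) k + p k * q k ^ N * a' (2 * m - 2) k) = 0"
  proof -
    have "fact (2 * m - 2) * (\<Sum>k=1..m - 1. d k * a (2 * m - 2) k + p k * q k ^ N * a' (2 * m - 2) k) = 0"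
      unfolding sys2[symmetric] sum_distrib_left a_def a'_def
      by (intro sum.cong refl left_end_sum[symmetric]) (use q in auto)
    then show ?thesis by simp
  qed
  have eq4: "(\<Sum>k=1..m - 1. d k * q k ^ N * a' (2 * m - 2) k + p k * a (2 * m - 2) k) = 0"
  proof -
    have "fact (2 * m - 2) * (\<Sum>k=1..m - 1. d k * q k ^ N * a' (2 * m - 2) k + p k * a (2 * m - 2) k) = 0"
      unfolding sys4[symmetric] sum_distrib_left a_def a'_def
      by (intro sum.cong refl right_end_sum[symmetric]) (use q in auto)
    then show ?thesis by simp
  qed

  \<comment> \<open>The value at node \<open>b\<close> of the spline of level \<open>n\<close>, before taking real or imaginary parts.\<close>
  define V where "V n b = fps_nth bernoulli_fps n - (\<Sum>k=1..m - 1. d k * q k ^ b * a (n - 1) k + p k * q k ^ (N - b) * a' (n - 1) k)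
      - (if n < 2 * m then 0 else fps_nth bernoulli_fps (2 * m) * of_nat b ^ (n - 2 * m) / fact (n - 2 * m))" for n b
  \<comment> \<open>The equations for \<open>j\<close> annihilate the derivative of order \<open>2 m - 1 - j\<close> at both ends.\<close>
  have low: "V (j + 1) 0 = 0 \<and> V (j + 1) N = 0" if j: "j \<in> {2..m - 1}" for j
  proof -
    define e :: complex where "e = (-1) ^ (j + 1)"
    have "e * e = 1" by (simp add: e_def flip: power_mult_distrib)
    have refl: "a' j k = e * a j k" if "k \<in> {1..m - 1}" for k
      using reflect[OF that, of j] j by (simp add: e_def)
    have "(\<Sum>k=1..m - 1. d k * a j k + p k * q k ^ N * a' j k) - (\<Sum>k=1..m - 1. d k * q k ^ N * a j k + p k * a' j k)
        = e * (\<Sum>k=1..m - 1. (1 - q k ^ N) * (d k * a' j k - p k * a j k))"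
      unfolding sum_subtractf[symmetric] sum_distrib_left
    proof (rule sum.cong)
      fix k assume k: "k \<in> {1..m - 1}"
      have "e * ((1 - q k ^ N) * (d k * (e * a j k) - p k * a j k))
          = (1 - q k ^ N) * ((e * e) * (d k * a j k) - e * (p k * a j k))"
        by (simp add: algebra_simps)
      then show "d k * a j k + p k * q k ^ N * a' j k - (d k * q k ^ N * a j k + p k * a' j k)
          = e * ((1 - q k ^ N) * (d k * a' j k - p k * a j k))"
        unfolding refl[OF k] \<open>e * e = 1\<close> by (simp add: algebra_simps)
    qed simp
    moreover have "j + 1 < 2 * m" using j by auto
    ultimately show ?thesis using eq1[OF j] eq3[OF j] by (simp add: V_def)
  qed
  \<comment> \<open>The remaining two equations annihilate the first derivative, as the odd Bernoulli number vanishes.\<close>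
  have first: "V (2 * m - 1) 0 = 0 \<and> V (2 * m - 1) N = 0"
  proof -
    have "bernoulli_num (2 * m - 1) = 0" using m by (intro bernoulli_num_odd) auto
    then have bern0: "fps_nth bernoulli_fps (2 * m - 1) = 0" by (simp add: bernoulli_fps_def)
    have refl: "a' (2 * m - 2) k = - a (2 * m - 2) k" if "k \<in> {1..m - 1}" for k
      using reflect[OF that, of "2 * m - 2"] m by (simp add: uminus_power_if)
    have "(\<Sum>k=1..m - 1. d k * q k ^ N * a (2 * m - 2) k + p k * a' (2 * m - 2) k)
        = - (\<Sum>k=1..m - 1. d k * q k ^ N * a' (2 * m - 2) k + p k * a (2 * m - 2) k)"
      unfolding sum_negf[symmetric] by (intro sum.cong) (simp_all add: refl)
    moreover have "2 * m - 1 - 1 = 2 * m - 2" by simp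
    ultimately show ?thesis using eq2 eq4 bern0 m by (simp add: V_def)
  qed
  \<comment> \<open>Here the choice of \<open>q k\<close> as roots of the Euler polynomial is used.\<close>
  have nodes: "V (2 * m) b = 0" for b
  proof -
    have "d k * q k ^ b * a (2 * m - 1) k + p k * q k ^ (N - b) * a' (2 * m - 1) k = 0" if "k \<in> {1..m - 1}" for k
      using root[OF that] reflect[OF that, of "2 * m - 1"] m by simp
    then show ?thesis by (simp add: V_def)
  qed

  define Z where "Z = extremal_fps m N q d p"
  define c where "c = node_coeff (m - 1) N q d p"
  define coeffs where "coeffs L = Abs_fps (\<lambda>j. (-1) ^ m * L (fps_nth Z j) * h ^ j)" for L :: "complex \<Rightarrow> real"
  define knots where "knots L = (\<lambda>\<beta>. h * ((-1) ^ m * L (c \<beta>)))" for L :: "complex \<Rightarrow> real"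
  have value_at: "spline (coeffs L) (knots L) N n (real b / real N) = h ^ n * ((-1) ^ m * L (V n b))"
    if "linear L" "n \<ge> 2" "b \<le> N" for L n b
  proof -
    have lin: "linear (\<lambda>z. (-1) ^ m * L z)"
      using linear_compose_scale_right[OF that(1), of "(-1) ^ m"] by simp
    have V: "V n b = fps_nth (Z * fps_exp (of_nat b)
        - fps_X * (\<Sum>\<beta>=1..b. fps_const (c \<beta>) * fps_exp (of_nat (b - \<beta>)))) n"
      unfolding Z_def c_def V_def a_def a'_def fps_nth_euler_part[symmetric]
      by (rule extremal_at_knot[symmetric]) (use q that in auto)
    show ?thesis unfolding coeffs_def knots_def V by (rule spline_at_knot[OF lin that(2,3) N h])
  qed
  have at_0: "spline (coeffs L) (knots L) N n 0 = h ^ n * ((-1) ^ m * L (V n 0))" if "linear L" "n \<ge> 2" for L n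
    using value_at[OF that, of 0] by simp
  have at_1: "spline (coeffs L) (knots L) N n 1 = h ^ n * ((-1) ^ m * L (V n N))" if "linear L" "n \<ge> 2" for L n
    using value_at[OF that, of N] N by simp
  have null: "null_spline m N (coeffs L) (knots L)" if L: "linear L" for L
    unfolding null_spline_def
  proof (intro conjI ballI allI impI)
    fix n assume n: "n \<in> {3..m} \<union> {2 * m - 1}"
    have "V n 0 = 0 \<and> V n N = 0"
    proof (cases "n = 2 * m - 1")
      case True
      then show ?thesis using first by simp
    next
      case False
      then have "n - 1 \<in> {2..m - 1}" "n - 1 + 1 = n" using n by auto
      then show ?thesis using low[of "n - 1"] by metis
    qed
    moreover have "n \<ge> 2" using n m by auto
    ultimately show "spline (coeffs L) (knots L) N n 0 = 0" "spline (coeffs L) (knots L) N n 1 = 0"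
      by (simp_all add: at_0[OF L] at_1[OF L] linear_0[OF L])
  next
    fix \<beta> assume "\<beta> \<le> N"
    then show "spline (coeffs L) (knots L) N (2 * m) (real \<beta> / real N) = 0"
      using value_at[OF L, of "2 * m" \<beta>] m nodes by (simp add: linear_0[OF L])
  qed
  have Z0: "fps_nth Z 0 = 1"
    using m by (simp add: Z_def extremal_fps_def bernoulli_fps_nth_0 fps_X_power_nth)
  have Re: "linear Re" and Im: "linear Im"
    by (simp_all add: bounded_linear.linear bounded_linear_Re bounded_linear_Im)
  have diff: "spline (coeffs L) (knots L) N (2 * m + 1) 1 - spline (coeffs L) (knots L) N (2 * m + 1) 0
      = h ^ (2 * m + 1) * ((-1) ^ m * L (V (2 * m + 1) N - V (2 * m + 1) 0))" if "linear L" for L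
    using m by (simp add: at_0[OF that] at_1[OF that] linear_diff[OF that] right_diff_distrib)
  \<comment> \<open>The real part is the extremal function; the imaginary part integrates to 0, so the formula is real.\<close>
  have re: "(real_of_ereal (error_norm m N C A B))\<^sup>2
      = h ^ (2 * m + 1) * ((-1) ^ m * Re (V (2 * m + 1) N - V (2 * m + 1) 0))"
    unfolding diff[OF Re, symmetric]
    by (rule optimal_error_norm[OF m N optimal null[OF Re]]) (simp add: coeffs_def Z0)
  have "h ^ (2 * m + 1) * ((-1) ^ m * Im (V (2 * m + 1) N - V (2 * m + 1) 0)) = 0"
    unfolding diff[OF Im, symmetric]
    by (rule null_spline_integral_eq_0[OF m N null[OF Re] _ null[OF Im]]) (simp_all add: coeffs_def Z0)
  then have im: "Im (V (2 * m + 1) N - V (2 * m + 1) 0) = 0" using h N by simp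
  have "V (2 * m + 1) N - V (2 * m + 1) 0 = of_real (Re (V (2 * m + 1) N - V (2 * m + 1) 0))"
    using im by (simp add: complex_eq_iff)
  then have norm2: "of_real ((real_of_ereal (error_norm m N C A B))\<^sup>2)
      = of_real (h ^ (2 * m + 1)) * ((-1) ^ m * (V (2 * m + 1) N - V (2 * m + 1) 0))"
    unfolding re by simp

  have refl: "a' (2 * m) k = - a (2 * m) k" if "k \<in> {1..m - 1}" for k
    using reflect[OF that, of "2 * m"] m by simp
  have "V (2 * m + 1) N - V (2 * m + 1) 0 = - of_nat N * fps_nth bernoulli_fps (2 * m)
      - ((\<Sum>k=1..m - 1. d k * q k ^ N * a (2 * m) k + p k * a' (2 * m) k)
         - (\<Sum>k=1..m - 1. d k * a (2 * m) k + p k * q k ^ N * a' (2 * m) k))"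
    by (simp add: V_def)
  also have "(\<Sum>k=1..m - 1. d k * q k ^ N * a (2 * m) k + p k * a' (2 * m) k)
         - (\<Sum>k=1..m - 1. d k * a (2 * m) k + p k * q k ^ N * a' (2 * m) k)
      = (\<Sum>k=1..m - 1. (1 - q k ^ N) * (d k * a' (2 * m) k - p k * a (2 * m) k))"
    unfolding sum_subtractf[symmetric]
  proof (rule sum.cong)
    fix k assume k: "k \<in> {1..m - 1}"
    show "d k * q k ^ N * a (2 * m) k + p k * a' (2 * m) k - (d k * a (2 * m) k + p k * q k ^ N * a' (2 * m) k)
        = (1 - q k ^ N) * (d k * a' (2 * m) k - p k * a (2 * m) k)"
      unfolding refl[OF k] by (simp add: algebra_simps)
  qed simp
  also have "\<dots> = (\<Sum>k=1..m - 1. \<Sum>i=0..2 * m.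
            (1 - q k ^ N) * (d k * q k ^ i + (-1) ^ i * p k * q k) / (1 - q k) ^ (i + 1)
              * of_real (diff_pow0 i (2 * m))) / fact (2 * m)"
    unfolding sum_divide_distrib
  proof (rule sum.cong)
    fix k assume "k \<in> {1..m - 1}"
    then have "(\<Sum>i=0..2 * m. (1 - q k ^ N) * (d k * q k ^ i + (-1) ^ i * p k * q k) / (1 - q k) ^ (i + 1)
              * of_real (diff_pow0 i (2 * m)))
        = fact (2 * m) * ((1 - q k ^ N) * (d k * a' (2 * m) k - p k * a (2 * m) k))"
      unfolding a_def a'_def by (intro end_difference_sum_alt) (use q in auto)
    then show "(1 - q k ^ N) * (d k * a' (2 * m) k - p k * a (2 * m) k)
      = (\<Sum>i=0..2 * m. (1 - q k ^ N) * (d k * q k ^ i + (-1) ^ i * p k * q k) / (1 - q k) ^ (i + 1)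
              * of_real (diff_pow0 i (2 * m)) / fact (2 * m))"
      by (simp only: sum_divide_distrib[symmetric]) simp
  qed simp
  finally have V_diff: "V (2 * m + 1) N - V (2 * m + 1) 0 = - of_nat N * fps_nth bernoulli_fps (2 * m)
      - (\<Sum>k=1..m - 1. \<Sum>i=0..2 * m.
            (1 - q k ^ N) * (d k * q k ^ i + (-1) ^ i * p k * q k) / (1 - q k) ^ (i + 1)
              * of_real (diff_pow0 i (2 * m))) / fact (2 * m)" .
  have hN: "of_real (h ^ (2 * m + 1)) * of_nat N = (of_real (h ^ (2 * m)) :: complex)"
    using h N by (simp add: power_divide)
  have collect: "H * (e * (- n * b - s / f)) = e * (- 1) * ((H * n) * b + H / f * s)" for H e n b s f :: complex
    by (simp add: algebra_simps)
  show ?thesis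
    unfolding norm2 V_diff collect hN by (simp add: bernoulli_fps_def)
qed

end
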